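(* Let $0<\varepsilon\le 0.001$. Let $\mathcal{A}$ be any randomized $\mathsf{LOCAL}$ algorithm that, for every $18$-regular bipartite graph $G=(V,E)$, computes a cut $E^\ast\subseteq E$ with $\mathbb{E}[|E^\ast|]\ge(1-\varepsilon)\cdot|E|$. Then the round complexity of $\mathcal{A}$ is $\Omega\left(\frac{\log n}{\varepsilon}\right)$, where $n=|V|$.
   Context: A cut is the set of edges crossing some bipartition $V=S\cup T$. Each edge decides whether it belongs to $E^\ast$. The $\mathsf{LOCAL}$ model on the graph $G$: synchronous rounds; in each round every vertex receives messages from its neighbours, performs arbitrary local computation and sends arbitrarily large messages to its neighbours; vertices are anonymous and have independent local random bits; the exact number of vertices $n$ is known to all vertices.
   Formalization: The algorithm's output is required to be a cut (almost surely) on every 18-regular graph, not only on bipartite ones; otherwise letting every edge join E* is a perfect 0-round algorithm on bipartite graphs, and the claim fails. *)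

theory Defs
  imports "HOL-Probability.Probability"
begin

section \<open>Finite simple graphs and cuts\<close>

definition simple_graph :: "nat set \<Rightarrow> nat set set \<Rightarrow> bool" where
  "simple_graph V E \<longleftrightarrow> finite V \<and> (\<forall>e\<in>E. e \<subseteq> V \<and> card e = 2)"

definition neighbours :: "nat set set \<Rightarrow> nat \<Rightarrow> nat set" where
  "neighbours E v = {u. {u, v} \<in> E \<and> u \<noteq> v}"

definition vertex_degree :: "nat set set \<Rightarrow> nat \<Rightarrow> nat" where
  "vertex_degree E v = card (neighbours E v)"

definition regular_graph :: "nat \<Rightarrow> nat set \<Rightarrow> nat set set \<Rightarrow> bool" where
  "regular_graph d V E \<longleftrightarrow> simple_graph V E \<and> (\<forall>v\<in>V. vertex_degree E v = d)"

definition crossing_edges :: "nat set set \<Rightarrow> nat set \<Rightarrow> nat set \<Rightarrow> nat set set" where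
  "crossing_edges E S T = {e\<in>E. e \<inter> S \<noteq> {} \<and> e \<inter> T \<noteq> {}}"

definition is_cut :: "nat set \<Rightarrow> nat set set \<Rightarrow> nat set set \<Rightarrow> bool" where
  "is_cut V E F \<longleftrightarrow> (\<exists>S T. S \<union> T = V \<and> S \<inter> T = {} \<and> F = crossing_edges E S T)"

definition bipartite :: "nat set \<Rightarrow> nat set set \<Rightarrow> bool" where
  "bipartite V E \<longleftrightarrow> (\<exists>S T. S \<union> T = V \<and> S \<inter> T = {} \<and> crossing_edges E S T = E)"


section \<open>Randomized LOCAL algorithms\<close>

text \<open>
  Infinite bit sequences serve as random tapes, as vertex states and as messages. A state or
  message can depend on nothing but the tapes of finitely many vertices and a finite amount of
  combinatorial data, so infinite bit sequences are large enough to encode anything an algorithm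
  could store or send; in particular message size and local computation are unrestricted.
\<close>

type_synonym bits = "nat \<Rightarrow> bool"

text \<open>
  Vertices are anonymous: a vertex addresses its neighbours only through local ports
  \<open>0, \<dots>, degree - 1\<close>, where \<open>port v u\<close> is the port of \<open>v\<close> that leads to \<open>u\<close>. Port numberings are
  chosen adversarially; algorithms that broadcast and ignore the ports are a special case.
\<close>

definition port_numbering :: "nat set \<Rightarrow> nat set set \<Rightarrow> (nat \<Rightarrow> nat \<Rightarrow> nat) \<Rightarrow> bool" where
  "port_numbering V E port \<longleftrightarrow>
     (\<forall>v\<in>V. bij_betw (port v) (neighbours E v) {..<vertex_degree E v})"

text \<open>
  The arguments of \<open>init\<close> are the number of vertices of the graph, the degree of the vertex and
  its random tape; the arguments of \<open>send\<close> are a state and the outgoing port; \<open>receive\<close> gets the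
  current state and the set of all pairs (port, message arriving at that port). The number of
  rounds is a function of the number of vertices, which every vertex knows. Finally each edge
  decides whether it belongs to the output, based on the unordered pair of the final states of its
  endpoints, each tagged with the port at which the edge is attached.
\<close>

record local_algorithm =
  rounds :: "nat \<Rightarrow> nat"
  init :: "nat \<Rightarrow> nat \<Rightarrow> bits \<Rightarrow> bits"
  send :: "bits \<Rightarrow> nat \<Rightarrow> bits"
  receive :: "bits \<Rightarrow> (nat \<times> bits) set \<Rightarrow> bits"
  edge_decision :: "(bits \<times> nat) set \<Rightarrow> bool"

fun state_after ::
  "local_algorithm \<Rightarrow> nat set \<Rightarrow> nat set set \<Rightarrow> (nat \<Rightarrow> nat \<Rightarrow> nat) \<Rightarrow> (nat \<Rightarrow> bits)
     \<Rightarrow> nat \<Rightarrow> nat \<Rightarrow> bits" where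
  "state_after A V E port \<omega> 0 v = init A (card V) (vertex_degree E v) (\<omega> v)"
| "state_after A V E port \<omega> (Suc t) v =
     receive A (state_after A V E port \<omega> t v)
       {(port v u, send A (state_after A V E port \<omega> t u) (port u v)) |u. u \<in> neighbours E v}"

definition output_edges ::
  "local_algorithm \<Rightarrow> nat set \<Rightarrow> nat set set \<Rightarrow> (nat \<Rightarrow> nat \<Rightarrow> nat) \<Rightarrow> (nat \<Rightarrow> bits)
     \<Rightarrow> nat set set" where
  "output_edges A V E port \<omega> =
     (let s = state_after A V E port \<omega> (rounds A (card V))
      in {{u, v} |u v. {u, v} \<in> E \<and> edge_decision A {(s u, port u v), (s v, port v u)}})"

definition tape_measure :: "bits measure" where
  "tape_measure = Pi\<^sub>M UNIV (\<lambda>_. measure_pmf (bernoulli_pmf (1/2)))"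

definition tapes_measure :: "nat set \<Rightarrow> (nat \<Rightarrow> bits) measure" where
  "tapes_measure V = Pi\<^sub>M V (\<lambda>_. tape_measure)"

text \<open>
  The local computations are arbitrary functions of the tapes, so it has to be demanded that the
  decision of every edge is an event.
\<close>

definition outputs_cut ::
  "local_algorithm \<Rightarrow> nat set \<Rightarrow> nat set set \<Rightarrow> (nat \<Rightarrow> nat \<Rightarrow> nat) \<Rightarrow> bool" where
  "outputs_cut A V E port \<longleftrightarrow>
     (\<forall>e\<in>E. {\<omega> \<in> space (tapes_measure V). e \<in> output_edges A V E port \<omega>}
              \<in> sets (tapes_measure V)) \<and>
     (AE \<omega> in tapes_measure V. is_cut V E (output_edges A V E port \<omega>))"

definition expected_output_size ::
  "local_algorithm \<Rightarrow> nat set \<Rightarrow> nat set set \<Rightarrow> (nat \<Rightarrow> nat \<Rightarrow> nat) \<Rightarrow> real" where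
  "expected_output_size A V E port =
     (\<integral>\<omega>. real (card (output_edges A V E port \<omega>)) \<partial>tapes_measure V)"

text \<open>
  An algorithm for the maximum cut problem on \<open>d\<close>-regular graphs whose approximation guarantee
  holds on the bipartite ones. That the output is a cut, i.e. a feasible solution of the problem, is
  demanded on all \<open>d\<close>-regular graphs. Were it demanded on bipartite graphs only, then letting every
  edge join the output would be a perfect algorithm without any communication, since the set of all
  edges of a bipartite graph is a cut. An algorithm in which the vertices choose their sides and
  an edge joins the output iff its endpoints chose differently meets the first condition on every
  graph (if the choices are events).
\<close>

definition approximates_bipartite_max_cut :: "nat \<Rightarrow> real \<Rightarrow> local_algorithm \<Rightarrow> bool" where
  "approximates_bipartite_max_cut d \<epsilon> A \<longleftrightarrow>
     (\<forall>V E port. regular_graph d V E \<and> port_numbering V E port \<longrightarrow> outputs_cut A V E port) \<and>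
     (\<forall>V E port. regular_graph d V E \<and> bipartite V E \<and> port_numbering V E port \<longrightarrow>
        expected_output_size A V E port \<ge> (1 - \<epsilon>) * real (card E))"

end

theory Submission
  imports Defs "HOL-Real_Asymp.Real_Asymp"
begin

text \<open>
  Let \<open>H\<close> be an 18-regular graph in which every ball of radius \<open>T\<close> is bipartite. Its bipartite double
  cover \<open>G\<close> and two disjoint copies of \<open>H\<close> have the same number of vertices, and an algorithm with at
  most \<open>T\<close> rounds that starts from lifted port numberings cannot tell them apart: an edge joins the
  output in both graphs with the same probability. On the copies of \<open>H\<close> the output is a cut, hence
  on \<open>G\<close> the expected output misses at least as large a fraction of the edges as every cut of \<open>H\<close>
  does. So \<open>H\<close> has to be such that every cut misses more than an \<open>\<epsilon>\<close>-fraction of the edges although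
  \<open>T\<close> is of order \<open>ln n / \<epsilon>\<close>.

  To build \<open>H\<close>, let each of \<open>m\<close> vertices choose three random neighbours. A first moment computation
  shows that, after deleting a small fraction of the edges, no short cycles and no degrees above 18
  remain while every cut still misses \<open>m / 10\<close> edges. Replacing the edges by paths of length \<open>2 k + 1\<close>
  with \<open>k\<close> of order \<open>1 / \<epsilon>\<close> stretches the odd cycles by this factor without changing the number
  of edges that a cut has to miss. Finally 36 copies are joined to make the graph regular, and a
  bipartite graph takes up the remaining vertices.
\<close>

subsection \<open>Subdividing edges\<close>

definition graph_on :: "'a set \<Rightarrow> ('a \<Rightarrow> 'a \<Rightarrow> bool) \<Rightarrow> bool" where
  "graph_on V adj \<longleftrightarrow> finite V \<and> (\<forall>x y. adj x y \<longrightarrow> x \<in> V \<and> y \<in> V \<and> adj y x \<and> x \<noteq> y)"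

text \<open>
  The function \<open>d\<close> is a lower bound for the distance from \<open>u\<close>, and \<open>s\<close> is a two-colouring that is
  proper on all edges that touch the ball of radius \<open>T\<close> around \<open>u\<close>.
\<close>

definition locally_bipartite :: "'a set \<Rightarrow> ('a \<Rightarrow> 'a \<Rightarrow> bool) \<Rightarrow> nat \<Rightarrow> bool" where
  "locally_bipartite V adj T \<longleftrightarrow>
     (\<forall>u\<in>V. \<exists>(d :: 'a \<Rightarrow> nat) (s :: 'a \<Rightarrow> bool). d u = 0 \<and>
        (\<forall>x y. adj x y \<longrightarrow> d y \<le> Suc (d x)) \<and>
        (\<forall>x y. adj x y \<longrightarrow> d x \<le> T \<longrightarrow> s x \<noteq> s y))"

text \<open>Pairs are ordered, so every monochromatic edge counts twice.\<close>

definition mono_pairs :: "('a \<Rightarrow> 'a \<Rightarrow> bool) \<Rightarrow> ('a \<Rightarrow> bool) \<Rightarrow> ('a \<times> 'a) set" where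
  "mono_pairs adj col = {(x, y). adj x y \<and> col x = col y}"

lemma graph_on_finite_pairs:
  assumes "graph_on V adj"
  shows "finite {(x, y). adj x y \<and> P x y}"
  by (rule finite_subset[of _ "V \<times> V"]) (use assms in \<open>auto simp: graph_on_def\<close>)

lemma graph_on_finite_nbrs:
  assumes "graph_on V adj"
  shows "finite {y. adj x y}"
  by (rule finite_subset[of _ V]) (use assms in \<open>auto simp: graph_on_def\<close>)

text \<open>
  The edge \<open>{x, y}\<close> becomes the path \<open>chain k x y 0, \<dots>, chain k x y (2 * k + 1)\<close>. To avoid choosing an
  orientation, \<open>(x, y)\<close> owns the \<open>k\<close> inner vertices closer to \<open>x\<close> and \<open>(y, x)\<close> the others.
\<close>

definition node :: "'a \<Rightarrow> 'a \<Rightarrow> nat \<Rightarrow> 'a \<times> 'a \<times> nat" where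
  "node x y p = (if p = 0 then (x, x, 0) else (x, y, p))"

definition chain :: "nat \<Rightarrow> 'a \<Rightarrow> 'a \<Rightarrow> nat \<Rightarrow> 'a \<times> 'a \<times> nat" where
  "chain k x y i = (if i \<le> k then node x y i else node y x (2 * k + 1 - i))"

definition subdiv_adj ::
  "nat \<Rightarrow> ('a \<Rightarrow> 'a \<Rightarrow> bool) \<Rightarrow> 'a \<times> 'a \<times> nat \<Rightarrow> 'a \<times> 'a \<times> nat \<Rightarrow> bool" where
  "subdiv_adj k adj P Q \<longleftrightarrow>
     (\<exists>x y i. adj x y \<and> i \<le> 2 * k \<and> P = chain k x y i \<and> Q = chain k x y (Suc i))"

definition subdiv_verts ::
  "nat \<Rightarrow> 'a set \<Rightarrow> ('a \<Rightarrow> 'a \<Rightarrow> bool) \<Rightarrow> ('a \<times> 'a \<times> nat) set" where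
  "subdiv_verts k V adj = (\<lambda>x. (x, x, 0)) ` V \<union> (\<lambda>((x, y), p). (x, y, p)) ` ({(x, y). adj x y} \<times> {1..k})"

lemma chain_reverse: "i \<le> 2 * k + 1 \<Longrightarrow> chain k y x (2 * k + 1 - i) = chain k x y i"
  by (auto simp: chain_def node_def)

lemma chain_ends [simp]: "chain k x y 0 = (x, x, 0)" "chain k x y (Suc (2 * k)) = (y, y, 0)"
  by (auto simp: chain_def node_def)

text \<open>A directed step lies on only one directed path: an inner vertex names both ends of its
  path, and its index grows on the half next to the start and falls on the other half, which reveals
  the direction. For \<open>k = 0\<close> the step itself is the pair of ends.\<close>

lemma chain_step_inj:
  assumes "x \<noteq> y" "i \<le> 2 * k" "j \<le> 2 * k"
    and "chain k x y i = chain k x' y' j" "chain k x y (Suc i) = chain k x' y' (Suc j)"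
  shows "x = x' \<and> y = y'"
proof (cases "i < k")
  case True
  then have "chain k x y (Suc i) = (x, y, Suc i)" "chain k x y i = node x y i"
    by (auto simp: chain_def node_def)
  then show ?thesis using assms True
    by (cases "j < k"; cases "j = k") (auto simp: chain_def node_def split: if_splits)
next
  case False
  then have "chain k x y (Suc i) = node y x (2 * k - i)"
    "chain k x y i = (if i = k then node x y k else (y, x, Suc (2 * k - i)))"
    using assms(2) by (auto simp: chain_def node_def)
  then show ?thesis using assms False
    by (cases "j < k"; cases "j = k") (auto simp: chain_def node_def split: if_splits)
qed

lemma graph_on_subdiv:
  assumes "graph_on V adj"
  shows "graph_on (subdiv_verts k V adj) (subdiv_adj k adj)"
proof -
  have fin: "finite (subdiv_verts k V adj)"
    using assms graph_on_finite_pairs[OF assms, of "\<lambda>_ _. True"]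
    by (auto simp: subdiv_verts_def graph_on_def)
  have mem: "chain k x y i \<in> subdiv_verts k V adj" if "adj x y" "i \<le> 2 * k + 1" for x y i
  proof -
    have "x \<in> V" "y \<in> V" "adj y x" using assms that by (auto simp: graph_on_def)
    then have "node x y p \<in> subdiv_verts k V adj" "node y x p \<in> subdiv_verts k V adj" if "p \<le> k" for p
      using that \<open>adj x y\<close> by (cases p; force simp: subdiv_verts_def node_def)+
    then show ?thesis using that by (simp add: chain_def)
  qed
  have sym: "subdiv_adj k adj Q P" if "subdiv_adj k adj P Q" for P Q
  proof -
    obtain x y i where h: "adj x y" "i \<le> 2 * k" "P = chain k x y i" "Q = chain k x y (Suc i)"
      using \<open>subdiv_adj k adj P Q\<close> by (auto simp: subdiv_adj_def)
    have "Q = chain k y x (2 * k - i)"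
      using chain_reverse[of "Suc i" k y x] h by simp
    moreover have "P = chain k y x (Suc (2 * k - i))"
      using chain_reverse[of i k y x] h by (simp add: Suc_diff_le)
    moreover have "adj y x" using assms h by (auto simp: graph_on_def)
    ultimately show ?thesis unfolding subdiv_adj_def
      by (intro exI[of _ y] exI[of _ x] exI[of _ "2 * k - i"]) simp
  qed
  have irr: "P \<noteq> Q" if "subdiv_adj k adj P Q" for P Q
  proof -
    obtain x y i where h: "adj x y" "i \<le> 2 * k" "P = chain k x y i" "Q = chain k x y (Suc i)"
      using \<open>subdiv_adj k adj P Q\<close> by (auto simp: subdiv_adj_def)
    moreover have "x \<noteq> y" using assms h by (auto simp: graph_on_def)
    ultimately show ?thesis by (auto simp: chain_def node_def split: if_splits)
  qed
  show ?thesis unfolding graph_on_def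
  proof (intro conjI allI impI)
    fix P Q assume a: "subdiv_adj k adj P Q"
    then show "P \<in> subdiv_verts k V adj" "Q \<in> subdiv_verts k V adj"
      by (auto simp: subdiv_adj_def intro!: mem)
    show "subdiv_adj k adj Q P" "P \<noteq> Q" using sym irr a by blast+
  qed (rule fin)
qed

lemma subdiv_degree:
  assumes g: "graph_on V adj" and deg: "\<And>x. x \<in> V \<Longrightarrow> card {y. adj x y} \<le> D" and D: "2 \<le> D"
    and P: "P \<in> subdiv_verts k V adj"
  shows "card {Q. subdiv_adj k adj P Q} \<le> D"
proof -
  consider x where "x \<in> V" "P = (x, x, 0)" | x y p where "adj x y" "1 \<le> p" "p \<le> k" "P = (x, y, p)"
    using P by (auto simp: subdiv_verts_def)
  then show ?thesis
  proof cases
    case 1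
    have "{Q. subdiv_adj k adj P Q} \<subseteq> (\<lambda>y. chain k x y 1) ` {y. adj x y}"
    proof
      fix Q assume "Q \<in> {Q. subdiv_adj k adj P Q}"
      then obtain x' y i where h: "adj x' y" "i \<le> 2 * k" "P = chain k x' y i" "Q = chain k x' y (Suc i)"
        by (auto simp: subdiv_adj_def)
      then have "i = 0" "x' = x" using 1 by (auto simp: chain_def node_def split: if_splits)
      then show "Q \<in> (\<lambda>y. chain k x y 1) ` {y. adj x y}" using h by auto
    qed
    then have "card {Q. subdiv_adj k adj P Q} \<le> card {y. adj x y}"
      using graph_on_finite_nbrs[OF g] by (meson surj_card_le)
    then show ?thesis using deg[OF 1(1)] by simp
  next
    case 2
    have "{Q. subdiv_adj k adj P Q} \<subseteq> {chain k x y (p - 1), chain k x y (Suc p)}"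
    proof
      fix Q assume "Q \<in> {Q. subdiv_adj k adj P Q}"
      then obtain x' y' i where h: "adj x' y'" "i \<le> 2 * k" "P = chain k x' y' i" "Q = chain k x' y' (Suc i)"
        by (auto simp: subdiv_adj_def)
      then have "(x' = x \<and> y' = y \<and> i = p) \<or> (x' = y \<and> y' = x \<and> i = 2 * k + 1 - p)"
        using 2 by (auto simp: chain_def node_def split: if_splits)
      then show "Q \<in> {chain k x y (p - 1), chain k x y (Suc p)}"
      proof
        assume c: "x' = y \<and> y' = x \<and> i = 2 * k + 1 - p"
        then have "Suc i = 2 * k + 1 - (p - 1)" using 2 by simp
        then have "Q = chain k x y (p - 1)"
          using chain_reverse[of "p - 1" k y x] h c 2 by simp
        then show ?thesis by simp
      qed (use h in simp)
    qed
    then have "card {Q. subdiv_adj k adj P Q} \<le> card {chain k x y (p - 1), chain k x y (Suc p)}"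
      by (intro card_mono) auto
    also have "\<dots> \<le> 2" by (simp add: card_insert_if)
    finally show ?thesis using D by simp
  qed
qed

lemma card_adj_pairs:
  assumes g: "graph_on V adj" and deg: "\<And>x. x \<in> V \<Longrightarrow> card {y. adj x y} \<le> D"
  shows "card {(x, y). adj x y} \<le> card V * D"
proof -
  have "{(x, y). adj x y} = (SIGMA x:V. {y. adj x y})"
    using g by (auto simp: graph_on_def)
  then have "card {(x, y). adj x y} = (\<Sum>x\<in>V. card {y. adj x y})"
    using g graph_on_finite_nbrs[OF g] by (auto simp: graph_on_def intro: card_SigmaI)
  also have "\<dots> \<le> (\<Sum>x\<in>V. D)" by (intro sum_mono deg)
  finally show ?thesis by simp
qed

lemma subdiv_card:
  assumes g: "graph_on V adj" and deg: "\<And>x. x \<in> V \<Longrightarrow> card {y. adj x y} \<le> D"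
  shows "card (subdiv_verts k V adj) \<le> card V * (1 + D * k)"
proof -
  have fin: "finite V" "finite {(x, y). adj x y}"
    using g graph_on_finite_pairs[OF g, of "\<lambda>_ _. True"] by (auto simp: graph_on_def)
  have "card (subdiv_verts k V adj) \<le> card V + card ({(x, y). adj x y} \<times> {1..k})"
    unfolding subdiv_verts_def
    by (intro order.trans[OF card_Un_le] add_mono card_image_le) (use fin in auto)
  also have "\<dots> \<le> card V + card V * D * k"
    using card_adj_pairs[OF g deg] by (simp add: card_cartesian_product)
  finally show ?thesis by (simp add: algebra_simps)
qed

text \<open>Colours cannot alternate along a path of odd length whose ends agree, so such a path
  contains a monochromatic step. Choosing one step for each ordered pair is injective by
  \<open>chain_step_inj\<close>.\<close>

lemma subdiv_mono_pairs:
  assumes g: "graph_on V adj"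
  shows "card (mono_pairs adj (\<lambda>x. col (x, x, 0))) \<le> card (mono_pairs (subdiv_adj k adj) col)"
proof -
  have ex: "\<exists>i\<le>2 * k. col (chain k x y i) = col (chain k x y (Suc i))"
    if "col (x, x, 0) = col (y, y, 0)" for x y
  proof (rule ccontr)
    assume "\<not> ?thesis"
    then have alt: "col (chain k x y i) \<noteq> col (chain k x y (Suc i))" if "i \<le> 2 * k" for i
      using that by blast
    have "i \<le> 2 * k + 1 \<Longrightarrow> col (chain k x y i) = (col (x, x, 0) \<noteq> odd i)" for i
    proof (induction i)
      case (Suc i)
      then show ?case using alt[of i] by auto
    qed simp
    from this[of "2 * k + 1"] show False using \<open>col (x, x, 0) = col (y, y, 0)\<close> by simp
  qed
  define I where "I x y = (SOME i. i \<le> 2 * k \<and> col (chain k x y i) = col (chain k x y (Suc i)))" for x y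
  have I: "I x y \<le> 2 * k" "col (chain k x y (I x y)) = col (chain k x y (Suc (I x y)))"
    if "col (x, x, 0) = col (y, y, 0)" for x y
    using someI_ex[of "\<lambda>i. i \<le> 2 * k \<and> col (chain k x y i) = col (chain k x y (Suc i))"] ex[OF that]
    unfolding I_def by auto
  let ?F = "\<lambda>(x, y). (chain k x y (I x y), chain k x y (Suc (I x y)))"
  show ?thesis
  proof (rule card_inj_on_le[where f = ?F])
    show "inj_on ?F (mono_pairs adj (\<lambda>x. col (x, x, 0)))"
    proof (rule inj_onI)
      fix p q assume p: "p \<in> mono_pairs adj (\<lambda>x. col (x, x, 0))"
        and q: "q \<in> mono_pairs adj (\<lambda>x. col (x, x, 0))" and e: "?F p = ?F q"
      obtain x y x' y' where xy: "p = (x, y)" "q = (x', y')" by (cases p, cases q)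
      have "x \<noteq> y" using p xy g by (auto simp: graph_on_def mono_pairs_def)
      moreover have "col (x, x, 0) = col (y, y, 0)" "col (x', x', 0) = col (y', y', 0)"
        using p q by (auto simp: xy mono_pairs_def)
      ultimately show "p = q"
        using chain_step_inj[of x y "I x y" k "I x' y'" x' y'] e I(1)[of x y] I(1)[of x' y']
        by (simp add: xy)
    qed
    show "?F ` mono_pairs adj (\<lambda>x. col (x, x, 0)) \<subseteq> mono_pairs (subdiv_adj k adj) col"
    proof
      fix p assume "p \<in> ?F ` mono_pairs adj (\<lambda>x. col (x, x, 0))"
      then obtain x y where "adj x y" "col (x, x, 0) = col (y, y, 0)"
        "p = (chain k x y (I x y), chain k x y (Suc (I x y)))"
        by (auto simp: mono_pairs_def)
      then show "p \<in> mono_pairs (subdiv_adj k adj) col"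
        using I[of x y] by (auto simp: mono_pairs_def subdiv_adj_def)
    qed
    show "finite (mono_pairs (subdiv_adj k adj) col)"
      unfolding mono_pairs_def by (rule graph_on_finite_pairs[OF graph_on_subdiv[OF g]])
  qed
qed

text \<open>Distances stretch by the factor \<open>l = 2 * k + 1\<close>. The centre may be an inner
  vertex, up to \<open>k\<close> steps away from its owner \<open>u\<close>, which is why
  \<open>k\<close> is subtracted from \<open>d'\<close>. A vertex within \<open>l * R\<close> of the
  centre then has \<open>d'\<close> below \<open>l * (R + 1)\<close>, so one end of its path has
  \<open>d \<le> R\<close> and the two ends are coloured differently.\<close>

lemma subdiv_locally_bipartite:
  assumes g: "graph_on V adj" and lb: "locally_bipartite V adj R"
  shows "locally_bipartite (subdiv_verts k V adj) (subdiv_adj k adj) ((2 * k + 1) * R)"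
  unfolding locally_bipartite_def
proof
  fix P assume P: "P \<in> subdiv_verts k V adj"
  obtain u v p where P': "P = (u, v, p)" by (cases P)
  then have u: "u \<in> V" "p \<le> k" using P g by (auto simp: subdiv_verts_def graph_on_def)
  then obtain d :: "'a \<Rightarrow> nat" and s :: "'a \<Rightarrow> bool" where
    d0: "d u = 0" and lip: "\<And>x y. adj x y \<Longrightarrow> d y \<le> Suc (d x)"
    and proper: "\<And>x y. adj x y \<Longrightarrow> d x \<le> R \<Longrightarrow> s x \<noteq> s y"
    using lb unfolding locally_bipartite_def by metis
  define l where "l = 2 * k + 1"
  \<comment> \<open>Distance from \<open>u\<close> when the path is entered through the better of
    its two ends.\<close>
  define d' where "d' = (\<lambda>(x, y, i). if i = 0 then l * d x else min (l * d x + i) (l * d y + (l - i)))"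
  define s' where "s' = (\<lambda>(x, y :: 'a, i :: nat). s x \<noteq> odd i)"
  have sym: "adj y x" if "adj x y" for x y using that g by (auto simp: graph_on_def)
  have d'_chain: "d' (chain k x y i) = min (l * d x + i) (l * d y + (l - i))"
    if "adj x y" "i \<le> l" for x y i
  proof -
    have "l * d x \<le> l * Suc (d y)" "l * d y \<le> l * Suc (d x)"
      using lip[OF that(1)] lip[OF sym[OF that(1)]] mult_le_mono2 by blast+
    then show ?thesis
      using that by (auto simp: d'_def chain_def node_def l_def)
  qed
  \<comment> \<open>Alternating from either end gives the same colours, because \<open>l\<close> is
    odd and the ends differ.\<close>
  have s'_chain: "s' (chain k x y i) = (s x \<noteq> odd i)" if "s x \<noteq> s y" "i \<le> l" for x y i
    using that by (auto simp: s'_def chain_def node_def l_def)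
  show "\<exists>(d :: _ \<Rightarrow> nat) (s :: _ \<Rightarrow> bool). d P = 0 \<and> (\<forall>x y. subdiv_adj k adj x y \<longrightarrow> d y \<le> Suc (d x)) \<and>
     (\<forall>x y. subdiv_adj k adj x y \<longrightarrow> d x \<le> (2 * k + 1) * R \<longrightarrow> s x \<noteq> s y)"
  proof (intro exI[of _ "\<lambda>Q. d' Q - k"] exI[of _ s'] conjI allI impI)
    show "d' P - k = 0" using u d0 by (auto simp: P' d'_def)
  next
    fix Q Q' assume "subdiv_adj k adj Q Q'"
    then obtain x y i where h: "adj x y" "i \<le> 2 * k" "Q = chain k x y i" "Q' = chain k x y (Suc i)"
      by (auto simp: subdiv_adj_def)
    then show "d' Q' - k \<le> Suc (d' Q - k)"
      using d'_chain[of x y i] d'_chain[of x y "Suc i"] by (auto simp: l_def min_def)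
    assume "d' Q - k \<le> (2 * k + 1) * R"
    then have "d' Q < l * Suc R" by (auto simp: l_def)
    then have "l * d x < l * Suc R \<or> l * d y < l * Suc R"
      using d'_chain[of x y i] h by (auto simp: l_def min_def split: if_splits)
    then have "d x \<le> R \<or> d y \<le> R" by (metis mult_less_cancel1 less_Suc_eq_le)
    then have "s x \<noteq> s y" using proper h(1) sym[OF h(1)] by blast
    then show "s' Q \<noteq> s' Q'" using s'_chain[of x y i] s'_chain[of x y "Suc i"] h by (auto simp: l_def)
  qed
qed

subsection \<open>Regularization by disjoint copies\<close>

text \<open>
  Each vertex has 36 copies, 18 on either side. The condition on \<open>(i + j) mod 18\<close> is symmetric and
  gives each copy of \<open>x\<close> exactly as many neighbours on the other side as \<open>x\<close> lacks.
\<close>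

definition reg_adj ::
  "('a \<Rightarrow> 'a \<Rightarrow> bool) \<Rightarrow> 'a \<times> nat \<times> bool \<Rightarrow> 'a \<times> nat \<times> bool \<Rightarrow> bool" where
  "reg_adj adj = (\<lambda>(x, i, b) (y, j, c). i < 18 \<and> j < 18 \<and>
     (if b = c then i = j \<and> adj x y else x = y \<and> (i + j) mod 18 < 18 - card {y. adj x y}))"

lemma inj_on_shift_mod: "inj_on (\<lambda>j. (i + j) mod q) {..<q :: nat}"
proof -
  have "j = j'" if "j \<le> j'" "j' < q" "(i + j) mod q = (i + j') mod q" for j j'
  proof -
    have "q dvd (i + j') - (i + j)"
      using that by (subst mod_eq_dvd_iff_nat[symmetric]) auto
    then show ?thesis using that by (auto dest: dvd_imp_le)
  qed
  then show ?thesis by (intro linorder_inj_onI) (auto dest: less_imp_le)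
qed

text \<open>Translation permutes the residues modulo \<open>q\<close>. This gives the degrees both
  between the two sides of \<open>reg_adj\<close> and in the graph that later fills up the vertex
  set.\<close>

lemma card_shift_mod:
  assumes "D \<le> (q :: nat)" "0 < q"
  shows "card {j. j < q \<and> (i + j) mod q < D} = D"
proof -
  let ?f = "\<lambda>j. (i + j) mod q"
  have "?f ` {..<q} = {..<q}"
    using assms inj_on_shift_mod by (intro endo_inj_surj) auto
  then have "?f ` {j. j < q \<and> ?f j < D} = {..<D}"
    using assms(1) by (auto simp: image_iff set_eq_iff) (metis less_le_trans lessThan_iff)
  moreover have "inj_on ?f {j. j < q \<and> ?f j < D}"
    by (rule inj_on_subset[OF inj_on_shift_mod]) auto
  ultimately show ?thesis using card_image[of ?f "{j. j < q \<and> ?f j < D}"] by simp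
qed

lemma graph_on_reg:
  assumes "graph_on V adj"
  shows "graph_on (V \<times> {..<18} \<times> UNIV) (\<lambda>P Q. fst P \<in> V \<and> reg_adj adj P Q)"
  using assms unfolding graph_on_def reg_adj_def
  by (auto split: if_splits simp: add.commute)

lemma reg_degree:
  assumes g: "graph_on V adj" and deg: "\<And>x. x \<in> V \<Longrightarrow> card {y. adj x y} \<le> 18"
    and P: "P \<in> V \<times> {..<18} \<times> UNIV"
  shows "card {Q. fst P \<in> V \<and> reg_adj adj P Q} = 18"
proof -
  obtain x i b where P': "P = (x, i, b)" "x \<in> V" "i < 18" using P by auto
  let ?A = "(\<lambda>y. (y, i, b)) ` {y. adj x y}"
  let ?B = "(\<lambda>j. (x, j, \<not> b)) ` {j. j < 18 \<and> (i + j) mod 18 < 18 - card {y. adj x y}}"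
  have un: "{Q. fst P \<in> V \<and> reg_adj adj P Q} = ?A \<union> ?B"
    using P' by (auto simp: reg_adj_def split: if_splits)
  have cu: "card (?A \<union> ?B) = card ?A + card ?B"
    using graph_on_finite_nbrs[OF g] by (intro card_Un_disjoint) auto
  have cA: "card ?A = card {y. adj x y}" by (intro card_image inj_onI) auto
  have "card ?B = card {j. j < 18 \<and> (i + j) mod 18 < 18 - card {y. adj x y}}"
    by (intro card_image inj_onI) auto
  then have "card ?B = 18 - card {y. adj x y}" using card_shift_mod[of "18 - card {y. adj x y}" 18 i] by simp
  then show ?thesis using deg[OF P'(2)] un cu cA by simp
qed

text \<open>Edges between the sides do not move the first component, so \<open>d\<close> can be
  pulled back; adding the side to the colour makes these edges properly coloured as well.\<close>

lemma reg_locally_bipartite: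
  assumes g: "graph_on V adj" and lb: "locally_bipartite V adj T"
  shows "locally_bipartite (V \<times> {..<18} \<times> UNIV) (\<lambda>P Q. fst P \<in> V \<and> reg_adj adj P Q) T"
  unfolding locally_bipartite_def
proof
  fix P :: "'a \<times> nat \<times> bool" assume "P \<in> V \<times> {..<18} \<times> UNIV"
  then have "fst P \<in> V" by auto
  then obtain d :: "'a \<Rightarrow> nat" and s :: "'a \<Rightarrow> bool" where
    h: "d (fst P) = 0" "\<And>x y. adj x y \<Longrightarrow> d y \<le> Suc (d x)"
    "\<And>x y. adj x y \<Longrightarrow> d x \<le> T \<Longrightarrow> s x \<noteq> s y"
    using lb unfolding locally_bipartite_def by metis
  show "\<exists>(d :: _ \<Rightarrow> nat) (s :: _ \<Rightarrow> bool). d P = 0 \<and> (\<forall>x y. fst x \<in> V \<and> reg_adj adj x y \<longrightarrow> d y \<le> Suc (d x)) \<and>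
    (\<forall>x y. fst x \<in> V \<and> reg_adj adj x y \<longrightarrow> d x \<le> T \<longrightarrow> s x \<noteq> s y)"
    by (rule exI[of _ "\<lambda>Q. d (fst Q)"], rule exI[of _ "\<lambda>Q. s (fst Q) \<noteq> snd (snd Q)"])
      (use h in \<open>auto simp: reg_adj_def split: if_splits\<close>)
qed

lemma reg_mono_pairs:
  assumes g: "graph_on V adj" and lower: "\<And>col. b \<le> card (mono_pairs adj col)"
  shows "36 * b \<le> card (mono_pairs (\<lambda>P Q. fst P \<in> V \<and> reg_adj adj P Q) col)"
proof -
  let ?S = "SIGMA (i, b) : {..<18} \<times> UNIV. mono_pairs adj (\<lambda>x. col (x, i :: nat, b :: bool))"
  let ?F = "\<lambda>((i, b), (x, y)). ((x, i, b), (y, i, b))"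
  have fin: "finite (mono_pairs adj c)" for c
    unfolding mono_pairs_def by (rule graph_on_finite_pairs[OF g])
  have "36 * b = (\<Sum>p \<in> {..<18 :: nat} \<times> (UNIV :: bool set). b)"
    by (simp add: card_cartesian_product)
  also have "\<dots> \<le> (\<Sum>(i, b) \<in> {..<18} \<times> UNIV. card (mono_pairs adj (\<lambda>x. col (x, i, b))))"
    by (intro sum_mono) (auto intro: lower)
  also have "\<dots> = card ?S"
    by (subst card_SigmaI) (auto simp: fin case_prod_unfold)
  also have "\<dots> \<le> card (mono_pairs (\<lambda>P Q. fst P \<in> V \<and> reg_adj adj P Q) col)"
  proof (rule card_inj_on_le[where f = ?F])
    show "inj_on ?F ?S" by (auto intro!: inj_onI)
    show "?F ` ?S \<subseteq> mono_pairs (\<lambda>P Q. fst P \<in> V \<and> reg_adj adj P Q) col"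
      using g by (auto simp: mono_pairs_def reg_adj_def graph_on_def)
    show "finite (mono_pairs (\<lambda>P Q. fst P \<in> V \<and> reg_adj adj P Q) col)"
      unfolding mono_pairs_def by (rule graph_on_finite_pairs[OF graph_on_reg[OF g]])
  qed
  finally show ?thesis .
qed

text \<open>Renaming of the vertices, because the graphs on which algorithms run have natural
  numbers as vertices.\<close>

lemma graph_on_nat:
  fixes adj :: "'a \<Rightarrow> 'a \<Rightarrow> bool"
  assumes g: "graph_on V adj" and deg: "\<And>x. x \<in> V \<Longrightarrow> card {y. adj x y} = D"
    and lb: "locally_bipartite V adj T" and lower: "\<And>col. b \<le> card (mono_pairs adj col)"
  obtains adj' :: "nat \<Rightarrow> nat \<Rightarrow> bool"
  where "graph_on {..<card V} adj'" "\<And>x. x < card V \<Longrightarrow> card {y. adj' x y} = D"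
    "locally_bipartite {..<card V} adj' T" "\<And>col. b \<le> card (mono_pairs adj' col)"
proof -
  have "finite V" using g by (auto simp: graph_on_def)
  then obtain f where f: "bij_betw f {..<card V} V"
    using bij_betw_from_nat_into_finite by blast
  define g' where "g' = the_inv_into {..<card V} f"
  have g': "bij_betw g' V {..<card V}" using f by (simp add: g'_def bij_betw_the_inv_into)
  have gf: "g' (f i) = i" if "i < card V" for i
    using f that by (simp add: g'_def bij_betw_def the_inv_into_f_f)
  have fg: "f (g' x) = x" if "x \<in> V" for x
    using f that by (simp add: g'_def bij_betw_def f_the_inv_into_f)
  have fV: "f i \<in> V" if "i < card V" for i using f that by (auto simp: bij_betw_def)
  have gV: "g' x < card V" if "x \<in> V" for x using g' that by (auto simp: bij_betw_def)
  define adj' where "adj' i j \<longleftrightarrow> i < card V \<and> j < card V \<and> adj (f i) (f j)" for i j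
  have inV: "x \<in> V" "y \<in> V" if "adj x y" for x y using g that by (auto simp: graph_on_def)
  show ?thesis
  proof (rule that)
    show gr: "graph_on {..<card V} adj'"
      using g f by (auto simp: graph_on_def adj'_def)
    show "card {y. adj' x y} = D" if "x < card V" for x
    proof -
      have "{y. adj' x y} = g' ` {y. adj (f x) y}"
      proof (intro set_eqI iffI)
        fix y assume "y \<in> {y. adj' x y}"
        then show "y \<in> g' ` {y. adj (f x) y}"
          by (auto simp: adj'_def intro!: image_eqI[of _ _ "f y"] gf[symmetric])
      qed (use that inV gV fg in \<open>auto simp: adj'_def\<close>)
      moreover have "inj_on g' {y. adj (f x) y}"
        by (rule inj_on_subset[of _ V]) (use g' inV in \<open>auto simp: bij_betw_def\<close>)
      ultimately show ?thesis using deg[OF fV[OF that]] by (simp add: card_image)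
    qed
    show "locally_bipartite {..<card V} adj' T"
      unfolding locally_bipartite_def
    proof
      fix u assume "u \<in> {..<card V}"
      then have "f u \<in> V" using fV by auto
      then obtain d :: "'a \<Rightarrow> nat" and s :: "'a \<Rightarrow> bool" where
        "d (f u) = 0" "\<And>x y. adj x y \<Longrightarrow> d y \<le> Suc (d x)"
        "\<And>x y. adj x y \<Longrightarrow> d x \<le> T \<Longrightarrow> s x \<noteq> s y"
        using lb unfolding locally_bipartite_def by metis
      then show "\<exists>(d :: _ \<Rightarrow> nat) (s :: _ \<Rightarrow> bool). d u = 0 \<and> (\<forall>x y. adj' x y \<longrightarrow> d y \<le> Suc (d x)) \<and>
          (\<forall>x y. adj' x y \<longrightarrow> d x \<le> T \<longrightarrow> s x \<noteq> s y)"
        by (intro exI[of _ "d \<circ> f"] exI[of _ "s \<circ> f"]) (auto simp: adj'_def)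
    qed
    show "b \<le> card (mono_pairs adj' col)" for col
    proof -
      have "card (mono_pairs adj (col \<circ> g')) \<le> card (mono_pairs adj' col)"
      proof (rule card_inj_on_le[where f = "map_prod g' g'"])
        show "inj_on (map_prod g' g') (mono_pairs adj (col \<circ> g'))"
          by (rule inj_on_subset[of _ "V \<times> V"])
            (use g' inV in \<open>auto simp: bij_betw_def mono_pairs_def intro: map_prod_inj_on\<close>)
        show "map_prod g' g' ` mono_pairs adj (col \<circ> g') \<subseteq> mono_pairs adj' col"
          using inV fg gV by (auto simp: mono_pairs_def adj'_def)
        show "finite (mono_pairs adj' col)"
          unfolding mono_pairs_def by (rule graph_on_finite_pairs[OF gr])
      qed
      then show ?thesis using lower[of "col \<circ> g'"] by linarith
    qed
  qed
qed

lemma subdivided_regular_graph: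
  fixes adj :: "'a \<Rightarrow> 'a \<Rightarrow> bool"
  assumes g: "graph_on V adj" and deg: "\<And>x. x \<in> V \<Longrightarrow> card {y. adj x y} \<le> 18"
    and lb: "locally_bipartite V adj R" and lower: "\<And>col. b \<le> card (mono_pairs adj col)"
  obtains h and adj' :: "nat \<Rightarrow> nat \<Rightarrow> bool"
  where "h \<le> 36 * (card V * (1 + 18 * k))"
    "graph_on {..<h} adj'" "\<And>x. x < h \<Longrightarrow> card {y. adj' x y} = 18"
    "locally_bipartite {..<h} adj' ((2 * k + 1) * R)"
    "\<And>col. 36 * b \<le> card (mono_pairs adj' col)"
proof -
  define W where "W = subdiv_verts k V adj"
  define B where "B = subdiv_adj k adj"
  have B: "graph_on W B" "\<And>x. x \<in> W \<Longrightarrow> card {y. B x y} \<le> 18"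
    "locally_bipartite W B ((2 * k + 1) * R)" "\<And>col. b \<le> card (mono_pairs B col)"
    unfolding W_def B_def
    using graph_on_subdiv[OF g] subdiv_degree[OF g deg] subdiv_locally_bipartite[OF g lb]
      order.trans[OF lower subdiv_mono_pairs[OF g]] by auto
  define W' where "W' = W \<times> {..<18 :: nat} \<times> (UNIV :: bool set)"
  have c: "card W' \<le> 36 * (card V * (1 + 18 * k))"
    using subdiv_card[OF g deg, of k] by (simp add: W'_def W_def card_cartesian_product)
  show ?thesis
  proof (rule graph_on_nat[OF graph_on_reg[OF B(1)] reg_degree[OF B(1,2)]
        reg_locally_bipartite[OF B(1,3)] reg_mono_pairs[OF B(1,4)]], goal_cases)
    case (3 adj')
    then show ?case using that[of "card W'" adj'] c by (simp add: W'_def)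
  qed auto
qed

subsection \<open>Sparse random graphs far from bipartite\<close>

text \<open>A repeated vertex splits an odd closed walk into two shorter closed walks, one of which
  is odd. Iterating this ends in an odd cycle without repetition.\<close>

lemma no_short_odd_closed_walk:
  assumes nocyc: "\<And>l v. odd l \<Longrightarrow> l \<le> L \<Longrightarrow> inj_on v {..<l} \<Longrightarrow>
      (\<And>i. i < l \<Longrightarrow> adj (v i) (v (Suc i mod l))) \<Longrightarrow> False"
  shows "odd l \<Longrightarrow> l \<le> L \<Longrightarrow> w l = w 0 \<Longrightarrow> (\<And>i. i < l \<Longrightarrow> adj (w i) (w (Suc i))) \<Longrightarrow> False"
proof (induction l arbitrary: w rule: less_induct)
  case (less l)
  show False
  proof (cases "inj_on w {..<l}")
    case True
    have "adj (w i) (w (Suc i mod l))" if "i < l" for i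
      using less.prems(3) less.prems(4)[OF that] that by (cases "Suc i = l") auto
    then show False using nocyc less.prems(1,2) True by blast
  next
    case False
    then obtain i j where ij: "i < j" "j < l" "w i = w j"
      unfolding inj_on_def by (metis lessThan_iff nat_neq_iff)
    show False
    proof (cases "odd (j - i)")
      case True
      show False
        by (rule less.IH[of "j - i" "\<lambda>n. w (i + n)"])
          (use ij True less.prems in auto)
    next
      case even: False
      \<comment> \<open>The even detour between the two visits is cut out.\<close>
      define w' where "w' n = (if n \<le> i then w n else w (n + (j - i)))" for n
      show False
      proof (rule less.IH[of "l - (j - i)" w'])
        show "odd (l - (j - i))" using even less.prems(1) ij by auto
        show "w' (l - (j - i)) = w' 0" using ij less.prems(3) by (auto simp: w'_def)
        show "adj (w' n) (w' (Suc n))" if "n < l - (j - i)" for n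
        proof (cases "n = i")
          case True
          then show ?thesis using ij less.prems(4)[of j] by (simp add: w'_def)
        next
          case False
          then show ?thesis
            using less.prems(4)[of n] less.prems(4)[of "n + (j - i)"] ij that by (simp add: w'_def)
        qed
      qed (use ij less.prems(2) in auto)
    qed
  qed
qed

text \<open>The colour is the parity of the distance from \<open>u\<close>. An edge between vertices
  at equal distance \<open>d \<le> R\<close> would close an odd walk of length
  \<open>2 * d + 1\<close>.\<close>

lemma locally_bipartite_if_no_short_odd_cycle:
  assumes g: "graph_on V adj"
    and nocyc: "\<And>l v. odd l \<Longrightarrow> l \<le> 2 * R + 1 \<Longrightarrow> inj_on v {..<l} \<Longrightarrow>
      (\<And>i. i < l \<Longrightarrow> adj (v i) (v (Suc i mod l))) \<Longrightarrow> False"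
  shows "locally_bipartite V adj R"
  unfolding locally_bipartite_def
proof
  fix u assume "u \<in> V"
  have sym: "adj y x" if "adj x y" for x y using that g by (auto simp: graph_on_def)
  have symp: "(adj ^^ n) y x" if "(adj ^^ n) x y" for n x y
    using that
  proof (induction n arbitrary: y)
    case (Suc n)
    then obtain z where "(adj ^^ n) x z" "adj z y" by (auto simp: relcompp_apply)
    then show ?case using Suc.IH sym by (metis relpowp_Suc_I2)
  qed auto
  define d where "d x = (if \<exists>n. (adj ^^ n) u x then LEAST n. (adj ^^ n) u x else R + 1)" for x
  have d_walk: "(adj ^^ d x) u x" if "(adj ^^ n) u x" for x n
    using that LeastI_ex[of "\<lambda>n. (adj ^^ n) u x"] by (auto simp: d_def)
  have d_le: "d x \<le> n" if "(adj ^^ n) u x" for x n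
    using that Least_le[of "\<lambda>n. (adj ^^ n) u x"] by (auto simp: d_def)
  have lip: "d y \<le> Suc (d x)" if "adj x y" for x y
  proof (cases "\<exists>n. (adj ^^ n) u x")
    case True
    then show ?thesis using d_walk d_le relpowp_Suc_I that by metis
  next
    case False
    then have "\<nexists>n. (adj ^^ n) u y" using relpowp_Suc_I sym[OF that] by metis
    then show ?thesis using False by (simp add: d_def)
  qed
  have proper: "odd (d x) \<noteq> odd (d y)" if "adj x y" "d x \<le> R" for x y
  proof
    assume "odd (d x) = odd (d y)"
    moreover have "d y \<le> Suc (d x)" "d x \<le> Suc (d y)" using lip that sym by blast+
    ultimately have eq: "d x = d y" by presburger
    have "\<exists>n. (adj ^^ n) u x" using that(2) by (auto simp: d_def split: if_splits)
    then have wx: "(adj ^^ d x) u x" using d_walk by blast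
    then have "(adj ^^ d y) u y" using relpowp_Suc_I[OF wx that(1)] d_walk by blast
    then have "(adj ^^ d x) y u" using symp eq by simp
    then have "(adj ^^ (Suc (d x) + d x)) u u"
      using relpowp_Suc_I[OF wx that(1)] by (auto simp: relpowp_add relcompp_apply simp del: add_Suc)
    then obtain w where w: "w 0 = u" "w (Suc (d x) + d x) = u"
      "\<forall>i<Suc (d x) + d x. adj (w i) (w (Suc i))"
      by (auto simp: relpowp_fun_conv simp del: add_Suc)
    show False
    proof (rule no_short_odd_closed_walk)
      show "w (Suc (d x) + d x) = w 0" "Suc (d x) + d x \<le> 2 * R + 1" using w that(2) by auto
      show "adj (w i) (w (Suc i))" if "i < Suc (d x) + d x" for i using w that by blast
    qed (rule nocyc, auto)
  qed
  have "d u = 0" using d_le[of 0 u] by simp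
  then show "\<exists>(d :: 'a \<Rightarrow> nat) (s :: 'a \<Rightarrow> bool). d u = 0 \<and> (\<forall>x y. adj x y \<longrightarrow> d y \<le> Suc (d x)) \<and>
      (\<forall>x y. adj x y \<longrightarrow> d x \<le> R \<longrightarrow> s x \<noteq> s y)"
    using lip proper by (intro exI[of _ d] exI[of _ "\<lambda>x. odd (d x)"]) blast
qed

section \<open>First moments for a uniformly random arc map\<close>

lemma card_PiE_fixed:
  assumes "finite A" "D \<subseteq> A" "\<And>x. x \<in> D \<Longrightarrow> g x \<in> V"
  shows "card {f \<in> A \<rightarrow>\<^sub>E V. \<forall>x\<in>D. f x = g x} = card V ^ (card A - card D)"
proof -
  have "{f \<in> A \<rightarrow>\<^sub>E V. \<forall>x\<in>D. f x = g x} = PiE A (\<lambda>x. if x \<in> D then {g x} else V)"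
  proof (intro set_eqI iffI)
    fix f assume f: "f \<in> PiE A (\<lambda>x. if x \<in> D then {g x} else V)"
    have "f x \<in> (if x \<in> D then {g x} else V)" if "x \<in> A" for x
      using f that by (rule PiE_mem)
    then have "f x = g x" if "x \<in> D" for x
      using that assms(2) by (metis singletonD subsetD)
    moreover have "f \<in> A \<rightarrow>\<^sub>E V"
    proof (rule PiE_I)
      show "f x \<in> V" if "x \<in> A" for x
        using PiE_mem[OF f that] assms(3)[of x] by (cases "x \<in> D") auto
      show "f x = undefined" if "x \<notin> A" for x
        using PiE_arb[OF f that] .
    qed
    ultimately show "f \<in> {f \<in> A \<rightarrow>\<^sub>E V. \<forall>x\<in>D. f x = g x}" by blast
  qed (auto simp: PiE_iff)
  then have "card {f \<in> A \<rightarrow>\<^sub>E V. \<forall>x\<in>D. f x = g x} = (\<Prod>x\<in>A. if x \<in> D then 1 else card V)"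
    using assms(1) by (auto simp: card_PiE intro!: prod.cong)
  also have "\<dots> = (\<Prod>x\<in>A - D. card V)"
    by (rule prod.mono_neutral_cong_right) (use assms in auto)
  also have "\<dots> = card V ^ (card A - card D)"
    using assms by (simp add: card_Diff_subset finite_subset)
  finally show ?thesis .
qed

text \<open>
  Arc \<open>a < 3 * m\<close> leads from vertex \<open>a div 3\<close> to a random vertex \<open>f a\<close>. Deleting \<open>late_arcs\<close> leaves
  in-degrees of at most 15. A closed trail of length \<open>l\<close> is encoded by its vertices \<open>v i\<close> and codes
  \<open>c i < 6\<close>: the parity of \<open>c i\<close> tells in which direction the \<open>i\<close>-th arc is traversed, and \<open>c i div 2\<close>
  which of the three arcs of its tail it is. Lengths 1 and 2 capture loops and parallel arcs.
\<close>

definition late_arcs :: "nat \<Rightarrow> (nat \<Rightarrow> nat) \<Rightarrow> nat set" where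
  "late_arcs m f = {a. a < 3 * m \<and> 15 \<le> card {b. b < a \<and> f b = f a}}"

definition cycle_arc :: "nat \<Rightarrow> (nat \<Rightarrow> nat) \<Rightarrow> (nat \<Rightarrow> nat) \<Rightarrow> nat \<Rightarrow> nat" where
  "cycle_arc l v c i = 3 * (if odd (c i) then v (Suc i mod l) else v i) + c i div 2"

definition cycle_head :: "nat \<Rightarrow> (nat \<Rightarrow> nat) \<Rightarrow> (nat \<Rightarrow> nat) \<Rightarrow> nat \<Rightarrow> nat" where
  "cycle_head l v c i = (if odd (c i) then v i else v (Suc i mod l))"

definition short_cycles :: "nat \<Rightarrow> nat \<Rightarrow> (nat \<Rightarrow> nat) \<Rightarrow> (nat \<times> (nat \<Rightarrow> nat) \<times> (nat \<Rightarrow> nat)) set" where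
  "short_cycles m L f = (SIGMA l:{1..L}. {(v, c) \<in> ({..<l} \<rightarrow>\<^sub>E {..<m}) \<times> ({..<l} \<rightarrow>\<^sub>E {..<6}).
      inj_on (cycle_arc l v c) {..<l} \<and> (\<forall>i<l. f (cycle_arc l v c i) = cycle_head l v c i)})"

definition arc_tail :: "nat \<Rightarrow> nat" where
  "arc_tail a = a div 3"

definition uncut :: "nat \<Rightarrow> nat set \<Rightarrow> (nat \<Rightarrow> nat) \<Rightarrow> nat set" where
  "uncut m S f = {a. a < 3 * m \<and> (arc_tail a \<in> S \<longleftrightarrow> f a \<in> S)}"

lemma finite_late_arcs [simp]: "finite (late_arcs m f)"
  by (simp add: late_arcs_def)

lemma finite_short_cycles [simp]: "finite (short_cycles m L f)"
  by (rule finite_subset[of _ "SIGMA l:{1..L}. ({..<l} \<rightarrow>\<^sub>E {..<m}) \<times> ({..<l} \<rightarrow>\<^sub>E {..<6 :: nat})"])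
    (auto simp: short_cycles_def intro!: finite_PiE)

text \<open>A late arc has the same head as at least 15 earlier arcs. There are at most
  \<open>9 * m^2 / 2\<close> pairs of arcs, each sharing its head with probability
  \<open>1 / m\<close>, so the expected number of late arcs is at most
  \<open>4.5 * m / 15 = 0.3 * m\<close>.\<close>

lemma sum_late_arcs:
  "(\<Sum>f\<in>{..<3 * m} \<rightarrow>\<^sub>E {..<m}. real (card (late_arcs m f))) \<le> 0.3 * m * real m ^ (3 * m)"
proof (cases "m = 0")
  case False
  let ?\<Omega> = "{..<3 * m} \<rightarrow>\<^sub>E {..<m}"
  have fin: "finite ?\<Omega>" by (intro finite_PiE) auto
  have 1: "15 * card (late_arcs m f) \<le> (\<Sum>a<3 * m. \<Sum>b<a. of_bool (f b = f a))" for f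
  proof -
    have "15 * card (late_arcs m f) = (\<Sum>a\<in>late_arcs m f. 15)" by simp
    also have "\<dots> \<le> (\<Sum>a\<in>late_arcs m f. card {b. b < a \<and> f b = f a})"
      by (intro sum_mono) (auto simp: late_arcs_def)
    also have "\<dots> \<le> (\<Sum>a<3 * m. card {b. b < a \<and> f b = f a})"
      by (intro sum_mono2) (auto simp: late_arcs_def)
    also have "\<dots> = (\<Sum>a<3 * m. \<Sum>b<a. of_bool (f b = f a))"
      by (intro sum.cong refl) (simp add: Int_def lessThan_def)
    finally show ?thesis .
  qed
  have 2: "(\<Sum>f\<in>?\<Omega>. of_bool (f b = f a)) = m ^ (3 * m - 1)" if "b < a" "a < 3 * m" for a b
  proof -
    have "(\<Sum>f\<in>?\<Omega>. of_bool (f b = f a)) = card {f \<in> ?\<Omega>. f b = f a}"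
      using fin by (simp add: Int_def)
    also have "{f \<in> ?\<Omega>. f b = f a} = (\<Union>y<m. {f \<in> ?\<Omega>. \<forall>x\<in>{a, b}. f x = y})"
      using that by (auto simp: PiE_def Pi_def)
    also have "card \<dots> = (\<Sum>y<m. card {f \<in> ?\<Omega>. \<forall>x\<in>{a, b}. f x = y})"
      by (intro card_UN_disjoint) (auto intro: finite_subset[OF _ fin])
    also have "\<dots> = (\<Sum>y<m. m ^ (3 * m - 2))"
      using that by (intro sum.cong refl, subst card_PiE_fixed) (auto simp: numeral_2_eq_2)
    also have "\<dots> = m ^ Suc (3 * m - 2)" by simp
    also have "Suc (3 * m - 2) = 3 * m - 1" using False by simp
    finally show ?thesis .
  qed
  have "15 * (\<Sum>f\<in>?\<Omega>. card (late_arcs m f)) \<le> (\<Sum>f\<in>?\<Omega>. \<Sum>a<3 * m. \<Sum>b<a. of_bool (f b = f a))"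
    unfolding sum_distrib_left by (intro sum_mono 1)
  also have "\<dots> = (\<Sum>a<3 * m. \<Sum>b<a. \<Sum>f\<in>?\<Omega>. of_bool (f b = f a))"
    by (subst sum.swap) (intro sum.cong refl sum.swap)
  also have "\<dots> = (\<Sum>a<3 * m. \<Sum>b<a. m ^ (3 * m - 1))"
    by (intro sum.cong refl 2) auto
  also have "\<dots> = (\<Sum>a<3 * m. a) * m ^ (3 * m - 1)" by (simp add: sum_distrib_right)
  finally have A: "15 * (\<Sum>f\<in>?\<Omega>. card (late_arcs m f)) \<le> (\<Sum>a<3 * m. a) * m ^ (3 * m - 1)" .
  have "2 * (\<Sum>a<n. a) \<le> n * n" for n :: nat by (induction n) auto
  from this[of "3 * m"] have "2 * (\<Sum>a<3 * m. a) * m ^ (3 * m - 1) \<le> (3 * m * (3 * m)) * m ^ (3 * m - 1)"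
    by (rule mult_right_mono) simp
  also have "\<dots> = 9 * m * m ^ Suc (3 * m - 1)" by simp
  also have "Suc (3 * m - 1) = 3 * m" using False by simp
  finally have "30 * (\<Sum>f\<in>?\<Omega>. card (late_arcs m f)) \<le> 9 * m * m ^ (3 * m)" using A by linarith
  then have "real (30 * (\<Sum>f\<in>?\<Omega>. card (late_arcs m f))) \<le> real (9 * m * m ^ (3 * m))"
    by (rule of_nat_mono)
  then show ?thesis by simp
qed (simp add: late_arcs_def)

text \<open>There are \<open>(6 * m) ^ l\<close> codes of length \<open>l\<close>. Each prescribes
  the heads of \<open>l\<close> distinct arcs, which has probability \<open>1 / m ^ l\<close>, so at
  most \<open>6 ^ l\<close> closed trails of length \<open>l\<close> are expected.\<close>

lemma sum_short_cycles:
  "(\<Sum>f\<in>{..<3 * m} \<rightarrow>\<^sub>E {..<m}. card (short_cycles m L f)) \<le> (\<Sum>l=1..L. 6 ^ l) * m ^ (3 * m)"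
proof -
  let ?\<Omega> = "{..<3 * m} \<rightarrow>\<^sub>E {..<m}"
  let ?vc = "\<lambda>l. ({..<l} \<rightarrow>\<^sub>E {..<m}) \<times> ({..<l} \<rightarrow>\<^sub>E {..<6 :: nat})"
  let ?valid = "\<lambda>f l (v, c). inj_on (cycle_arc l v c) {..<l} \<and>
      (\<forall>i<l. f (cycle_arc l v c i) = cycle_head l v c i)"
  have fin: "finite ?\<Omega>" "finite (?vc l)" for l :: nat
    by (intro finite_cartesian_product finite_PiE finite_lessThan)+
  have 1: "card {f \<in> ?\<Omega>. ?valid f l p} * m ^ l \<le> m ^ (3 * m)" if p: "p \<in> ?vc l" for l p
  proof -
    obtain v c where vc: "p = (v, c)" "v \<in> {..<l} \<rightarrow>\<^sub>E {..<m}" "c \<in> {..<l} \<rightarrow>\<^sub>E {..<6}"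
      using p by (cases p) auto
    have vm: "v i < m" "v (Suc i mod l) < m" "c i < 6" if "i < l" for i
      using vc(2,3) that by (auto simp: PiE_def Pi_def)
    have arc: "cycle_arc l v c i < 3 * m" "cycle_head l v c i < m" if "i < l" for i
      using vm[OF that] by (auto simp: cycle_arc_def cycle_head_def)
    show ?thesis
    proof (cases "inj_on (cycle_arc l v c) {..<l}")
      case True
      define D where "D = cycle_arc l v c ` {..<l}"
      define g where "g a = cycle_head l v c (the_inv_into {..<l} (cycle_arc l v c) a)" for a
      have g: "g (cycle_arc l v c i) = cycle_head l v c i" if "i < l" for i
        using True that by (simp add: g_def the_inv_into_f_f)
      have D: "card D = l" "D \<subseteq> {..<3 * m}"
        using True arc by (auto simp: D_def card_image)
      then have l: "l \<le> 3 * m" using card_mono[of "{..<3 * m}" D] by simp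
      have "{f \<in> ?\<Omega>. ?valid f l p} = {f \<in> ?\<Omega>. \<forall>a\<in>D. f a = g a}"
        using True g by (auto simp: vc(1) D_def)
      also have "card \<dots> = m ^ (3 * m - l)"
        using D by (subst card_PiE_fixed) (auto simp: D_def g arc)
      finally show ?thesis using l by (simp flip: power_add)
    qed (simp add: vc(1))
  qed
  have "(\<Sum>f\<in>?\<Omega>. card (short_cycles m L f)) = (\<Sum>f\<in>?\<Omega>. \<Sum>l=1..L. card {p \<in> ?vc l. ?valid f l p})"
  proof (intro sum.cong refl)
    fix f
    have "short_cycles m L f = (SIGMA l:{1..L}. {p \<in> ?vc l. ?valid f l p})"
      by (auto simp: short_cycles_def)
    then show "card (short_cycles m L f) = (\<Sum>l=1..L. card {p \<in> ?vc l. ?valid f l p})"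
      using card_SigmaI[of "{1..L}" "\<lambda>l. {p \<in> ?vc l. ?valid f l p}"] finite_subset[OF _ fin(2)]
      by (metis (no_types, lifting) finite_atLeastAtMost mem_Collect_eq subsetI)
  qed
  also have "\<dots> = (\<Sum>f\<in>?\<Omega>. \<Sum>l=1..L. \<Sum>p\<in>?vc l. of_bool (?valid f l p))"
    by (intro sum.cong refl) (simp only: sum_of_bool_eq fin Int_def mem_Collect_eq Collect_mem_eq of_nat_id)
  also have "\<dots> = (\<Sum>l=1..L. \<Sum>p\<in>?vc l. \<Sum>f\<in>?\<Omega>. of_bool (?valid f l p))"
    by (subst sum.swap) (intro sum.cong refl sum.swap)
  also have "\<dots> = (\<Sum>l=1..L. \<Sum>p\<in>?vc l. card {f \<in> ?\<Omega>. ?valid f l p})"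
    by (intro sum.cong refl) (simp only: sum_of_bool_eq fin Int_def mem_Collect_eq Collect_mem_eq of_nat_id)
  also have "\<dots> \<le> (\<Sum>l=1..L. 6 ^ l * m ^ (3 * m))"
  proof (intro sum_mono)
    fix l assume "l \<in> {1..L}"
    show "(\<Sum>p\<in>?vc l. card {f \<in> ?\<Omega>. ?valid f l p}) \<le> 6 ^ l * m ^ (3 * m)"
    proof (cases "m = 0")
      case True
      then have "{..<l} \<rightarrow>\<^sub>E {..<m} = {}" using \<open>l \<in> {1..L}\<close> by (auto simp: PiE_eq_empty_iff intro: exI[of _ 0])
      then show ?thesis by simp
    next
      case False
      have "(\<Sum>p\<in>?vc l. card {f \<in> ?\<Omega>. ?valid f l p}) * m ^ l \<le> (\<Sum>p\<in>?vc l. m ^ (3 * m))"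
        unfolding sum_distrib_right by (intro sum_mono 1)
      also have "\<dots> = (6 ^ l * m ^ (3 * m)) * m ^ l"
        by (simp add: card_cartesian_product card_PiE mult_ac)
      finally show ?thesis using False by simp
    qed
  qed
  finally show ?thesis by (simp add: sum_distrib_right)
qed

lemma sum_div_3:
  fixes h :: "nat \<Rightarrow> real"
  shows "(\<Sum>a<3 * m. h (a div 3)) = 3 * (\<Sum>x<m. h x)"
proof (induction m)
  case (Suc m)
  have "3 * Suc m = Suc (Suc (Suc (3 * m)))" by simp
  then have "(\<Sum>a<3 * Suc m. h (a div 3)) = (\<Sum>a<3 * m. h (a div 3)) +
      h (3 * m div 3) + h (Suc (3 * m) div 3) + h (Suc (Suc (3 * m)) div 3)"
    by (simp only: sum.lessThan_Suc)
  moreover have "Suc (3 * m) div 3 = m" "Suc (Suc (3 * m)) div 3 = m" by linarith+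
  ultimately have "(\<Sum>a<3 * Suc m. h (a div 3)) = (\<Sum>a<3 * m. h (a div 3)) + 3 * h m" by simp
  then show ?case using Suc by simp
qed simp

text \<open>The heads are independent, so the expectation of
  \<open>(1 / 4) ^ card (uncut m S f)\<close> is a product over the arcs. For a balanced
  \<open>S\<close> each factor is \<open>(1 / 4 + 1) / 2 = 5 / 8\<close>; this case is the
  worst.\<close>

lemma sum_uncut:
  assumes "0 < m" and S: "S \<subseteq> {..<m}"
  shows "(\<Sum>f\<in>{..<3 * m} \<rightarrow>\<^sub>E {..<m}. (1 / 4) ^ card (uncut m S f)) \<le> (5 / 8 * real m) ^ (3 * m)"
proof -
  define s t c where "s = real (card S)" and "t = real (card ({..<m} - S))" and "c = 5 / 8 * real m"
  have finS: "finite S" using S finite_subset by blast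
  have "card S \<le> m" using card_mono[OF _ S] by simp
  then have m: "real m = s + t" using S finS by (simp add: s_def t_def card_Diff_subset)
  define w where "w x = (if x \<in> S then s / 4 + t else t / 4 + s)" for x
  define \<phi> where "\<phi> a y = (if a div 3 \<in> S \<longleftrightarrow> y \<in> S then 1 / 4 else 1 :: real)" for a y :: nat
  have w: "(\<Sum>y<m. \<phi> a y) = w (a div 3)" for a
  proof -
    have "{..<m} = S \<union> ({..<m} - S)" using S by auto
    then have "(\<Sum>y<m. \<phi> a y) = (\<Sum>y\<in>S. \<phi> a y) + (\<Sum>y\<in>{..<m} - S. \<phi> a y)"
      using finS by (metis sum.subset_diff S finite_lessThan add.commute)
    also have "\<dots> = w (a div 3)"
      by (auto simp: \<phi>_def w_def s_def t_def)
    finally show ?thesis .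
  qed
  have pw: "(1 / 4 :: real) ^ card (uncut m S f) = (\<Prod>a<3 * m. \<phi> a (f a))" for f
  proof -
    have "(\<Prod>a<3 * m. \<phi> a (f a)) = (\<Prod>a\<in>uncut m S f. 1 / 4)"
      by (rule prod.mono_neutral_cong_right) (auto simp: uncut_def \<phi>_def arc_tail_def)
    then show ?thesis by simp
  qed
  \<comment> \<open>Since \<open>w / c \<le> exp (w / c - 1)\<close>, the product of the \<open>w\<close> is at most the power of \<open>c\<close> if they
    average at most \<open>c\<close>.\<close>
  have c: "c > 0" using assms by (simp add: c_def)
  have le: "w x \<le> c * exp (w x / c - 1)" for x
    using exp_ge_add_one_self[of "w x / c - 1"] c by (simp add: field_simps)
  have nn: "0 \<le> w x" for x by (simp add: w_def s_def t_def)
  have "(\<Sum>x<m. w x) = (\<Sum>x\<in>S. w x) + (\<Sum>x\<in>{..<m} - S. w x)"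
    using finS by (metis sum.subset_diff S finite_lessThan add.commute)
  also have "\<dots> = s * (s / 4 + t) + t * (t / 4 + s)" by (simp add: w_def s_def t_def)
  also have "\<dots> \<le> c * real m"
  proof -
    \<comment> \<open>This square is exactly the difference of the two sides.\<close>
    have "0 \<le> 3 / 8 * (s - t)\<^sup>2" by simp
    then show ?thesis unfolding c_def m by (simp add: power2_eq_square algebra_simps)
  qed
  finally have sw: "(\<Sum>x<m. w x) / c \<le> real m" using c by (simp add: field_simps)
  have "(\<Sum>f\<in>{..<3 * m} \<rightarrow>\<^sub>E {..<m}. (1 / 4 :: real) ^ card (uncut m S f)) = (\<Prod>a<3 * m. \<Sum>y<m. \<phi> a y)"
    by (subst prod_sum_PiE) (auto simp: pw)
  also have "\<dots> = (\<Prod>a<3 * m. w (a div 3))" by (simp add: w)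
  also have "\<dots> \<le> (\<Prod>a<3 * m. c * exp (w (a div 3) / c - 1))"
    by (intro prod_mono) (auto simp: nn le)
  also have "\<dots> = c ^ (3 * m) * exp (\<Sum>a<3 * m. w (a div 3) / c - 1)"
    by (simp add: prod.distrib exp_sum)
  also have "(\<Sum>a<3 * m. w (a div 3) / c - 1) = 3 * ((\<Sum>x<m. w x) / c - real m)"
    by (subst sum_div_3) (simp add: sum_subtractf sum_divide_distrib)
  also have "c ^ (3 * m) * exp \<dots> \<le> c ^ (3 * m) * 1"
    using sw c by (intro mult_left_mono) auto
  finally show ?thesis by (simp add: c_def)
qed

text \<open>Markov's inequality for \<open>(1 / 4) ^ card (uncut m S f)\<close>, which is at least
  \<open>1 / 2 ^ m\<close> on a bad cut, and a union bound over \<open>2 ^ m\<close> sets. With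
  three arcs per vertex the resulting base \<open>2 * 2 * (5 / 8) ^ 3 = 125 / 128\<close> is below
  1.\<close>

lemma sum_bad_cuts:
  assumes "0 < m"
  shows "(\<Sum>f\<in>{..<3 * m} \<rightarrow>\<^sub>E {..<m}. real (card {S. S \<subseteq> {..<m} \<and> 2 * card (uncut m S f) \<le> m}))
    \<le> (125 / 128) ^ m * real m ^ (3 * m)"
proof -
  let ?\<Omega> = "{..<3 * m} \<rightarrow>\<^sub>E {..<m}"
  have bad: "of_bool (2 * card (uncut m S f) \<le> m) \<le> 2 ^ m * (1 / 4 :: real) ^ card (uncut m S f)" for S f
  proof (cases "2 * card (uncut m S f) \<le> m")
    case True
    have "(1 / 2 :: real) ^ m \<le> (1 / 2) ^ (2 * card (uncut m S f))"
      using True by (intro power_decreasing) auto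
    also have "\<dots> = (1 / 4) ^ card (uncut m S f)" by (simp add: power_mult power2_eq_square)
    finally have "2 ^ m * (1 / 2 :: real) ^ m \<le> 2 ^ m * (1 / 4) ^ card (uncut m S f)"
      by (intro mult_left_mono) auto
    then show ?thesis using True by (simp flip: power_mult_distrib)
  qed simp
  have "(\<Sum>f\<in>?\<Omega>. real (card {S. S \<subseteq> {..<m} \<and> 2 * card (uncut m S f) \<le> m}))
      = (\<Sum>f\<in>?\<Omega>. \<Sum>S\<in>Pow {..<m}. of_bool (2 * card (uncut m S f) \<le> m))"
    by (intro sum.cong refl) (simp add: Int_def Pow_def)
  also have "\<dots> \<le> (\<Sum>f\<in>?\<Omega>. \<Sum>S\<in>Pow {..<m}. 2 ^ m * (1 / 4) ^ card (uncut m S f))"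
    by (intro sum_mono bad)
  also have "\<dots> = (\<Sum>S\<in>Pow {..<m}. 2 ^ m * (\<Sum>f\<in>?\<Omega>. (1 / 4) ^ card (uncut m S f)))"
    by (subst sum.swap) (simp add: sum_distrib_left)
  also have "\<dots> \<le> (\<Sum>S\<in>Pow {..<m}. 2 ^ m * (5 / 8 * real m) ^ (3 * m))"
    by (intro sum_mono mult_left_mono sum_uncut assms) auto
  also have "\<dots> = 2 ^ m * (2 ^ m * (5 / 8 * real m) ^ (3 * m))"
    by (simp add: card_Pow)
  also have "\<dots> = (2 * 2 * (5 / 8) ^ 3) ^ m * real m ^ (3 * m)"
  proof -
    have "(5 / 8 * real m) ^ (3 * m) = ((5 / 8) ^ 3) ^ m * real m ^ (3 * m)"
      by (simp add: power_mult_distrib power_mult power_divide)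
    then show ?thesis by (simp only: power_mult_distrib mult.assoc)
  qed
  also have "(2 * 2 * (5 / 8) ^ 3 :: real) = 125 / 128" by (simp add: power3_eq_cube)
  finally show ?thesis .
qed

text \<open>The three requirements are merged into one quantity \<open>?X\<close>: if it is below 1,
  each summand is, and the integral number of bad cuts is 0. Its average is below
  \<open>5 / 6 + 1 / 15 + 1 / 20 = 0.95\<close>.\<close>

lemma exists_good_arcs:
  assumes m: "200 \<le> m" and L: "100 * 6 ^ (L + 1) \<le> m"
  shows "\<exists>f. f \<in> {..<3 * m} \<rightarrow>\<^sub>E {..<m} \<and> real (card (late_arcs m f)) < 0.36 * m \<and>
    real (card (short_cycles m L f)) < 0.03 * m \<and>
    (\<forall>S. S \<subseteq> {..<m} \<longrightarrow> m < 2 * card (uncut m S f))"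
proof -
  let ?\<Omega> = "{..<3 * m} \<rightarrow>\<^sub>E {..<m}"
  let ?bad = "\<lambda>f. {S. S \<subseteq> {..<m} \<and> 2 * card (uncut m S f) \<le> m}"
  let ?X = "\<lambda>f. real (card (late_arcs m f)) / (0.36 * m) + real (card (short_cycles m L f)) / (0.03 * m)
      + real (card (?bad f))"
  have "\<exists>f\<in>?\<Omega>. ?X f < 1"
  proof (rule ccontr)
    assume "\<not> ?thesis"
    then have ge: "1 \<le> ?X f" if "f \<in> ?\<Omega>" for f using that by force
    define M where "M = real m ^ (3 * m)"
    have M: "M > 0" using m by (simp add: M_def)
    have geo: "5 * (\<Sum>l=1..L. 6 ^ l) \<le> (6 :: nat) ^ (L + 1)"
      by (induction L) auto
    then have geo': "real (\<Sum>l=1..L. 6 ^ l) \<le> 0.002 * m"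
    proof -
      have "500 * (\<Sum>l=1..L. 6 ^ l) \<le> m" using geo L by linarith
      then have "real (500 * (\<Sum>l=1..L. 6 ^ l)) \<le> real m" by (rule of_nat_mono)
      then show ?thesis by simp
    qed
    have A: "(\<Sum>f\<in>?\<Omega>. real (card (late_arcs m f))) / (0.36 * m) \<le> 5 / 6 * M"
      using sum_late_arcs[of m] m by (simp add: M_def field_simps)
    have "real (\<Sum>f\<in>?\<Omega>. card (short_cycles m L f)) \<le> real ((\<Sum>l=1..L. 6 ^ l) * m ^ (3 * m))"
      by (rule of_nat_mono[OF sum_short_cycles])
    also have "\<dots> = real (\<Sum>l=1..L. 6 ^ l) * M" by (simp only: of_nat_mult of_nat_power M_def)
    also have "\<dots> \<le> 0.002 * m * M" using geo' M by (intro mult_right_mono) auto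
    finally have B: "(\<Sum>f\<in>?\<Omega>. real (card (short_cycles m L f))) / (0.03 * m) \<le> 1 / 15 * M"
      using m by (simp add: field_simps)
    \<comment> \<open>Here \<open>(125 / 128) ^ 32 \<le> 1 / 2\<close>, and \<open>m\<close> is at
      least \<open>5 * 32\<close>, which gives \<open>1 / 32\<close>.\<close>
    have "(125 / 128 :: real) ^ m \<le> (125 / 128) ^ (32 * 5)" using m by (intro power_decreasing) auto
    also have "\<dots> = ((125 / 128) ^ 32) ^ 5" by (rule power_mult)
    also have "\<dots> \<le> (1 / 2) ^ 5" by (intro power_mono) (auto simp: power_divide)
    also have "\<dots> < 1 / (20 :: real)" by (simp add: power_divide)
    finally have "(125 / 128 :: real) ^ m * M < 1 / 20 * M" using M by (intro mult_strict_right_mono) auto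
    then have C: "(\<Sum>f\<in>?\<Omega>. real (card (?bad f))) < 1 / 20 * M"
      using sum_bad_cuts[of m] m unfolding M_def by linarith
    have "M = (\<Sum>f\<in>?\<Omega>. 1)" by (simp add: card_PiE M_def)
    also have "\<dots> \<le> (\<Sum>f\<in>?\<Omega>. ?X f)" by (intro sum_mono ge)
    also have "\<dots> = (\<Sum>f\<in>?\<Omega>. real (card (late_arcs m f))) / (0.36 * m)
        + (\<Sum>f\<in>?\<Omega>. real (card (short_cycles m L f))) / (0.03 * m) + (\<Sum>f\<in>?\<Omega>. real (card (?bad f)))"
      by (simp only: sum.distrib sum_divide_distrib)
    also have "\<dots> < 5 / 6 * M + 1 / 15 * M + 1 / 20 * M" using A B C by linarith
    finally show False using M by simp
  qed
  then obtain f where f: "f \<in> ?\<Omega>" "?X f < 1" by blast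
  have nn: "0 \<le> real (card (late_arcs m f)) / (0.36 * m)" "0 \<le> real (card (short_cycles m L f)) / (0.03 * m)"
    by auto
  have "real (card (late_arcs m f)) / (0.36 * m) < 1" using f nn by linarith
  moreover have "real (card (short_cycles m L f)) / (0.03 * m) < 1" using f nn by linarith
  moreover have "real (card (?bad f)) < 1" using f nn by linarith
  moreover have "finite (?bad f)" by (rule finite_subset[of _ "Pow {..<m}"]) auto
  then have "?bad f = {}" using \<open>real (card (?bad f)) < 1\<close> by (simp add: card_eq_0_iff)
  then have "m < 2 * card (uncut m S f)" if "S \<subseteq> {..<m}" for S
    using that by (auto simp: not_le[symmetric])
  ultimately show ?thesis using f(1) m by (intro exI[of _ f]) (simp add: field_simps)
qed

section \<open>The random graph after deleting late arcs and short closed trails\<close>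

definition links :: "(nat \<Rightarrow> nat) \<Rightarrow> nat \<Rightarrow> nat \<Rightarrow> nat \<Rightarrow> bool" where
  "links f a x y \<longleftrightarrow> (arc_tail a = x \<and> f a = y) \<or> (arc_tail a = y \<and> f a = x)"

text \<open>Every short closed trail with distinct arcs has a code in \<open>short_cycles\<close>.
  Deleting the first arc of each code therefore destroys all of them.\<close>

lemma short_cycle_first_arc:
  assumes "1 \<le> l" "l \<le> L" and v: "\<And>i. i < l \<Longrightarrow> v i < m"
    and al: "\<And>i. i < l \<Longrightarrow> links f (al i) (v i) (v (Suc i mod l))" and inj: "inj_on al {..<l}"
  shows "al 0 \<in> (\<lambda>(l, v, c). cycle_arc l v c 0) ` short_cycles m L f"
proof -
  define v' where "v' = restrict v {..<l}"
  \<comment> \<open>The position of the arc among the three of its tail, doubled, plus the bit for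
    backward traversal.\<close>
  define c where "c = restrict (\<lambda>i. 2 * (al i mod 3) +
    (if al i div 3 = v i \<and> f (al i) = v (Suc i mod l) then 0 else 1)) {..<l}"
  have v': "v' i = v i" "v' (Suc i mod l) = v (Suc i mod l)" if "i < l" for i
    using that by (auto simp: v'_def)
  have arc: "cycle_arc l v' c i = al i" and hd: "f (al i) = cycle_head l v' c i" if "i < l" for i
  proof -
    have ci: "c i = 2 * (al i mod 3) + (if al i div 3 = v i \<and> f (al i) = v (Suc i mod l) then 0 else 1)"
      using that by (simp add: c_def)
    have "cycle_arc l v' c i = al i \<and> f (al i) = cycle_head l v' c i"
    proof (cases "al i div 3 = v i \<and> f (al i) = v (Suc i mod l)")
      case True
      then have "3 * v i + al i mod 3 = al i" by (metis mult_div_mod_eq)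
      then show ?thesis
        using True ci v'[OF that] by (simp add: cycle_arc_def cycle_head_def)
    next
      case False
      then have "al i div 3 = v (Suc i mod l)" and h: "f (al i) = v i"
        using al[OF that] by (auto simp: links_def arc_tail_def)
      then have "3 * v (Suc i mod l) + al i mod 3 = al i" by (metis mult_div_mod_eq)
      moreover have "c i = 2 * (al i mod 3) + 1" using ci False by simp
      ultimately show ?thesis
        using h v'[OF that] by (simp add: cycle_arc_def cycle_head_def)
    qed
    then show "cycle_arc l v' c i = al i" "f (al i) = cycle_head l v' c i" by blast+
  qed
  have "c i < 6" if "i < l" for i
    using that mod_less_divisor[of 3 "al i"] by (auto simp: c_def)
  then have "c \<in> {..<l} \<rightarrow>\<^sub>E {..<6}" by (auto simp: PiE_iff c_def)
  moreover have "v' \<in> {..<l} \<rightarrow>\<^sub>E {..<m}" using v by (auto simp: v'_def)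
  moreover have "inj_on (cycle_arc l v' c) {..<l}"
    using inj arc by (auto simp: inj_on_def)
  ultimately have "(l, v', c) \<in> short_cycles m L f"
    using assms(1,2) arc hd by (auto simp: short_cycles_def)
  then show ?thesis using arc[of 0] assms(1) by force
qed

lemma links_self: "links f a (arc_tail a) (f a)" "links f a (f a) (arc_tail a)"
  by (simp_all add: links_def)

lemma links_sym: "links f a x y \<Longrightarrow> links f a y x"
  by (auto simp: links_def)

lemma links_endpoints:
  "links f a x y \<Longrightarrow> links f a x' y' \<Longrightarrow> (x = x' \<and> y = y') \<or> (x = y' \<and> y = x')"
  by (auto simp: links_def)

lemma card_arc_tail: "finite {a. arc_tail a = x}" "card {a. arc_tail a = x} \<le> 3"
proof -
  have "{a. arc_tail a = x} \<subseteq> {3 * x..<3 * x + 3}"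
    by (auto simp: arc_tail_def)
  then show "finite {a. arc_tail a = x}" "card {a. arc_tail a = x} \<le> 3"
    using card_mono[of "{3 * x..<3 * x + 3}" "{a. arc_tail a = x}"] finite_subset by auto
qed

text \<open>A vertex keeps at most 3 outgoing and 15 incoming arcs. Of more than
  \<open>m / 2\<close> uncut arcs fewer than \<open>0.36 * m + 0.03 * m\<close> are deleted, so at
  least \<open>m / 10\<close> remain, that is, \<open>m / 5\<close> ordered pairs.\<close>

lemma exists_base_graph:
  assumes m: "200 \<le> m" and R: "100 * 6 ^ (2 * R + 3) \<le> m"
  obtains adj :: "nat \<Rightarrow> nat \<Rightarrow> bool"
  where "graph_on {..<m} adj" "\<And>x. card {y. adj x y} \<le> 18" "locally_bipartite {..<m} adj R"
    "\<And>col. m \<le> 5 * card (mono_pairs adj col)"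
proof -
  \<comment> \<open>Odd cycles of length up to \<open>2 * R + 1\<close> have to go, and so do
    parallel arcs; the bound \<open>2 * R + 2\<close> covers length 2 even for
    \<open>R = 0\<close>.\<close>
  have L: "100 * 6 ^ (2 * R + 2 + 1) \<le> m"
  proof -
    have "2 * R + 2 + 1 = 2 * R + 3" by simp
    then show ?thesis using R by (simp only:)
  qed
  obtain f where f: "f \<in> {..<3 * m} \<rightarrow>\<^sub>E {..<m}" and late: "real (card (late_arcs m f)) < 0.36 * m"
    and short: "real (card (short_cycles m (2 * R + 2) f)) < 0.03 * m"
    and cut: "\<forall>S. S \<subseteq> {..<m} \<longrightarrow> m < 2 * card (uncut m S f)"
    using exists_good_arcs[OF m L] by (elim exE conjE) (rule that)
  define A where "A = {a. a < 3 * m} - late_arcs m f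
    - (\<lambda>(l, v, c). cycle_arc l v c 0) ` short_cycles m (2 * R + 2) f"
  define adj where "adj x y \<longleftrightarrow> (\<exists>a\<in>A. links f a x y)" for x y
  have fm: "f a < m" "arc_tail a < m" if "a \<in> A" for a
  proof -
    have a: "a < 3 * m" using that by (simp add: A_def)
    then show "f a < m" using PiE_mem[OF f, of a] by simp
    show "arc_tail a < m" using a by (simp add: arc_tail_def less_mult_imp_div_less mult.commute)
  qed
  have finA: "finite A" by (simp add: A_def)
  have no_cycle: "al 0 \<notin> A" if "1 \<le> l" "l \<le> 2 * R + 2" "\<And>i. i < l \<Longrightarrow> v i < m"
    "\<And>i. i < l \<Longrightarrow> links f (al i) (v i) (v (Suc i mod l))" "inj_on al {..<l}" for l v and al :: "nat \<Rightarrow> nat"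
    using short_cycle_first_arc[of l "2 * R + 2" v m f al] that unfolding A_def by blast
  have no_loop: "f a \<noteq> arc_tail a" if "a \<in> A" for a
  proof
    assume "f a = arc_tail a"
    then have "a \<notin> A"
      by (intro no_cycle[of 1 "\<lambda>_. f a" "\<lambda>_. a"]) (use fm[OF that] in \<open>auto simp: links_def inj_on_def\<close>)
    then show False using that by blast
  qed
  have g: "graph_on {..<m} adj"
    using fm no_loop by (fastforce simp: graph_on_def adj_def links_def)
  have deg: "card {y. adj x y} \<le> 18" for x
  proof -
    have out: "{y. adj x y} \<subseteq> f ` {a. arc_tail a = x} \<union> arc_tail ` {a \<in> A. f a = x}"
    proof
      fix y assume "y \<in> {y. adj x y}"
      then show "y \<in> f ` {a. arc_tail a = x} \<union> arc_tail ` {a \<in> A. f a = x}"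
        by (auto simp: adj_def links_def)
    qed
    \<comment> \<open>If more than 15 arcs into \<open>x\<close> survived, the last of them would be
      late.\<close>
    have ins: "card {a \<in> A. f a = x} \<le> 15"
    proof (rule ccontr)
      assume "\<not> ?thesis"
      then have big: "15 < card {a \<in> A. f a = x}" by simp
      define a where "a = Max {a \<in> A. f a = x}"
      have ne: "{a \<in> A. f a = x} \<noteq> {}" using big by (metis card.empty not_less0)
      then have a: "a \<in> A" "f a = x" using Max_in[of "{a \<in> A. f a = x}"] finA by (auto simp: a_def)
      have "{a \<in> A. f a = x} - {a} \<subseteq> {b. b < a \<and> f b = f a}"
        using Max_ge[of "{a \<in> A. f a = x}"] finA a by (auto simp: a_def order.strict_iff_order)
      then have "card ({a \<in> A. f a = x} - {a}) \<le> card {b. b < a \<and> f b = f a}"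
        by (intro card_mono) auto
      then have "a \<in> late_arcs m f" using big a finA by (auto simp: late_arcs_def A_def)
      then show False using a by (simp add: A_def)
    qed
    define Out where "Out = f ` {a. arc_tail a = x}"
    define In where "In = arc_tail ` {a \<in> A. f a = x}"
    have fin: "finite Out" "finite In" unfolding Out_def In_def using finA card_arc_tail by simp_all
    have "card Out \<le> 3"
      unfolding Out_def using card_image_le[OF card_arc_tail(1)] card_arc_tail(2) by (rule order.trans)
    moreover have "card In \<le> card {a \<in> A. f a = x}"
      unfolding In_def by (rule card_image_le) (simp add: finA)
    moreover have "{y. adj x y} \<subseteq> Out \<union> In" unfolding Out_def In_def by (rule out)
    then have "card {y. adj x y} \<le> card (Out \<union> In)" by (rule card_mono[rotated]) (simp add: fin)
    moreover have "card (Out \<union> In) \<le> card Out + card In" by (rule card_Un_le)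
    ultimately show ?thesis using ins by linarith
  qed
  have lb: "locally_bipartite {..<m} adj R"
  proof (rule locally_bipartite_if_no_short_odd_cycle[OF g])
    fix l v assume l: "odd l" "l \<le> 2 * R + 1" and inj: "inj_on v {..<l}"
      and adj: "\<And>i. i < l \<Longrightarrow> adj (v i) (v (Suc i mod l))"
    have l0: "1 \<le> l" "l \<noteq> 2" using l by (auto elim: oddE)
    define al where "al i = (SOME a. a \<in> A \<and> links f a (v i) (v (Suc i mod l)))" for i
    have al: "al i \<in> A" "links f (al i) (v i) (v (Suc i mod l))" if "i < l" for i
      using someI_ex[of "\<lambda>a. a \<in> A \<and> links f a (v i) (v (Suc i mod l))"] adj[OF that]
      unfolding adj_def al_def by blast+
    have v: "v i < m" if "i < l" for i
      using adj[OF that] g unfolding graph_on_def by blast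
    \<comment> \<open>An arc used at two positions would be traversed in opposite directions, so
      each position would follow the other cyclically. That forces \<open>l = 2\<close>, which is
      not odd.\<close>
    have "inj_on al {..<l}"
    proof (rule inj_onI, rule ccontr)
      fix i j assume ij: "i \<in> {..<l}" "j \<in> {..<l}" "al i = al j" "i \<noteq> j"
      then have "v i \<noteq> v j" using inj_onD[OF inj, of i j] by blast
      moreover have "links f (al i) (v i) (v (Suc i mod l))" "links f (al i) (v j) (v (Suc j mod l))"
        using al(2)[of i] al(2)[of j] ij(1,2) unfolding ij(3) lessThan_iff by blast+
      ultimately have "v i = v (Suc j mod l) \<and> v (Suc i mod l) = v j"
        using links_endpoints by blast
      then have e: "v i = v (Suc j mod l)" "v j = v (Suc i mod l)" by simp_all
      have lt: "Suc i mod l \<in> {..<l}" "Suc j mod l \<in> {..<l}" using l0 by auto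
      have "i = Suc j mod l" "j = Suc i mod l"
        using inj_onD[OF inj e(1) ij(1) lt(2)] inj_onD[OF inj e(2) ij(2) lt(1)] by blast+
      moreover have "Suc r mod l = 0 \<and> Suc r = l \<or> Suc r mod l = Suc r" if "r < l" for r
        using that by (cases "Suc r = l") auto
      ultimately have "i = 0 \<and> Suc j = l \<or> i = Suc j" "j = 0 \<and> Suc i = l \<or> j = Suc i"
        using ij(1,2) by (metis lessThan_iff)+
      then show False using ij(4) l0 by arith
    qed
    then have "al 0 \<notin> A" using l l0 v al(2) by (intro no_cycle[of l v al]) auto
    then show False using al(1)[of 0] l0 by simp
  qed
  \<comment> \<open>Two parallel arcs would form a closed trail of length 2. Hence distinct arcs
    yield distinct edges and the count of uncut arcs passes to edges.\<close>
  have link_unique: "a = b" if ab: "a \<in> A" "b \<in> A" "links f a x y" "links f b x y" for a b x y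
  proof (rule ccontr)
    assume "a \<noteq> b"
    define al v where "al i = (if i = 0 then a else b)" and "v i = (if i = 0 then x else y)" for i :: nat
    have "al 0 \<notin> A"
    proof (rule no_cycle[of 2 v al])
      show "v i < m" if "i < 2" for i
        using fm[OF ab(1)] links_endpoints[OF ab(3) links_self(1)] by (auto simp: v_def)
      show "links f (al i) (v i) (v (Suc i mod 2))" if "i < 2" for i
      proof -
        have "i = 0 \<or> i = 1" using that by linarith
        then show ?thesis using ab(3) links_sym[OF ab(4)] by (auto simp: v_def al_def)
      qed
      show "inj_on al {..<2}" using \<open>a \<noteq> b\<close> by (auto simp: inj_on_def al_def)
    qed auto
    then show False using ab by (simp add: al_def)
  qed
  have mono: "m \<le> 5 * card (mono_pairs adj col)" for col
  proof -
    define S where "S = {x. x < m \<and> col x}"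
    define B where "B = uncut m S f \<inter> A"
    have "uncut m S f \<subseteq> B \<union> late_arcs m f \<union> (\<lambda>(l, v, c). cycle_arc l v c 0) ` short_cycles m (2 * R + 2) f"
      by (auto simp: B_def A_def uncut_def)
    then have "card (uncut m S f) \<le> card (B \<union> late_arcs m f \<union> (\<lambda>(l, v, c). cycle_arc l v c 0) ` short_cycles m (2 * R + 2) f)"
      using finA by (intro card_mono) (auto simp: B_def)
    also have "\<dots> \<le> card B + card (late_arcs m f) + card ((\<lambda>(l, v, c). cycle_arc l v c 0) ` short_cycles m (2 * R + 2) f)"
      by (intro order.trans[OF card_Un_le] add_mono order.refl)
    also have "\<dots> \<le> card B + card (late_arcs m f) + card (short_cycles m (2 * R + 2) f)"
      by (intro add_left_mono card_image_le) auto
    finally have "real (card (uncut m S f)) \<le> real (card B) + real (card (late_arcs m f))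
      + real (card (short_cycles m (2 * R + 2) f))" by linarith
    moreover have "real m < 2 * real (card (uncut m S f))" 
    proof -
      have "m < 2 * card (uncut m S f)" by (rule cut[rule_format]) (auto simp: S_def)
      then show ?thesis by simp
    qed
    moreover have "100 * real (card (late_arcs m f)) < 36 * real m"
      "100 * real (card (short_cycles m (2 * R + 2) f)) < 3 * real m"
      using late short by (simp_all add: power2_eq_square field_simps)
    ultimately have cB: "real m \<le> 10 * real (card B)" by linarith
    have "card (B \<times> (UNIV :: bool set)) \<le> card (mono_pairs adj col)"
    proof (rule card_inj_on_le[where f = "\<lambda>(a, b). if b then (arc_tail a, f a) else (f a, arc_tail a)"])
      show "inj_on (\<lambda>(a, b). if b then (arc_tail a, f a) else (f a, arc_tail a)) (B \<times> UNIV)"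
      proof (rule inj_onI, clarify)
        fix a b a' b' assume h: "a \<in> B" "a' \<in> B"
          "(if b then (arc_tail a, f a) else (f a, arc_tail a)) = (if b' then (arc_tail a', f a') else (f a', arc_tail a'))"
        then have "a = a'" using link_unique[of a a' "arc_tail a" "f a"]
          by (auto simp: B_def links_def split: if_splits)
        then show "a = a' \<and> b = b'" using h no_loop[of a] by (auto simp: B_def split: if_splits)
      qed
      show "(\<lambda>(a, b). if b then (arc_tail a, f a) else (f a, arc_tail a)) ` (B \<times> UNIV) \<subseteq> mono_pairs adj col"
      proof (rule image_subsetI)
        fix p :: "nat \<times> bool" assume "p \<in> B \<times> UNIV"
        then obtain a b where p: "p = (a, b)" and "a \<in> B" by auto
        then have "a \<in> A" "arc_tail a \<in> S \<longleftrightarrow> f a \<in> S" by (auto simp: B_def uncut_def)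
        moreover from this have "adj (arc_tail a) (f a)" "adj (f a) (arc_tail a)"
          unfolding adj_def using links_self by blast+
        ultimately show "(\<lambda>(a, b). if b then (arc_tail a, f a) else (f a, arc_tail a)) p \<in> mono_pairs adj col"
          using fm[of a] by (auto simp: p mono_pairs_def S_def)
      qed
      show "finite (mono_pairs adj col)"
        unfolding mono_pairs_def by (rule graph_on_finite_pairs[OF g])
    qed
    then show ?thesis using cB by (simp add: card_cartesian_product)
  qed
  show ?thesis by (rule that[OF g deg lb mono])
qed

subsection \<open>Indistinguishability\<close>

text \<open>Coordinates on a two-fold lift whose vertices are natural numbers: the vertex below, and
  the sheet. \<open>vtx\<close> is the inverse.\<close>

definition under :: "nat \<Rightarrow> nat" where
  "under p = p div 2"

definition side :: "nat \<Rightarrow> bool" where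
  "side p \<longleftrightarrow> odd p"

definition vtx :: "nat \<Rightarrow> bool \<Rightarrow> nat" where
  "vtx x b = 2 * x + of_bool b"

lemma under_vtx [simp]: "under (vtx x b) = x"
  by (simp add: under_def vtx_def)

lemma side_vtx [simp]: "side (vtx x b) = b"
  by (simp add: side_def vtx_def)

lemma vtx_under_side [simp]: "vtx (under p) (side p) = p"
  by (auto simp: under_def side_def vtx_def elim: evenE oddE)

lemma vtx_eqI: "under p = x \<Longrightarrow> side p = b \<Longrightarrow> p = vtx x b"
  using vtx_under_side[of p] by simp

lemma vtx_inject [simp]: "vtx x b = vtx y c \<longleftrightarrow> x = y \<and> b = c"
proof
  assume "vtx x b = vtx y c"
  then have "under (vtx x b) = under (vtx y c)" "side (vtx x b) = side (vtx y c)" by simp_all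
  then show "x = y \<and> b = c" by simp
qed simp

lemma under_less: "p < 2 * n \<longleftrightarrow> under p < n"
  by (auto simp: under_def)

section \<open>Expected output size as a sum of edge probabilities\<close>

lemma integral_tapes_card_output:
  assumes fin: "finite E" and cut: "outputs_cut A V E port"
  shows "integrable (tapes_measure V) (\<lambda>\<omega>. real (card (output_edges A V E port \<omega>)))"
    and "expected_output_size A V E port =
      (\<Sum>e\<in>E. measure (tapes_measure V) {\<omega> \<in> space (tapes_measure V). e \<in> output_edges A V E port \<omega>})"
proof -
  let ?M = "tapes_measure V"
  let ?S = "\<lambda>e. {\<omega> \<in> space ?M. e \<in> output_edges A V E port \<omega>}"
  interpret prob_space ?M
    unfolding tapes_measure_def tape_measure_def
    by (intro prob_space_PiM prob_space_measure_pmf)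
  have S: "?S e \<in> sets ?M" if "e \<in> E" for e using cut that by (auto simp: outputs_cut_def)
  have sub: "output_edges A V E port \<omega> \<subseteq> E" for \<omega> by (auto simp: output_edges_def Let_def)
  have eq: "real (card (output_edges A V E port \<omega>)) = (\<Sum>e\<in>E. indicator (?S e) \<omega>)"
    if "\<omega> \<in> space ?M" for \<omega>
  proof -
    have "(\<Sum>e\<in>E. indicator (?S e) \<omega>) = (\<Sum>e\<in>output_edges A V E port \<omega>. 1 :: real)"
      by (rule sum.mono_neutral_cong_right) (use fin sub that in \<open>auto simp: indicator_def\<close>)
    then show ?thesis by simp
  qed
  have int: "integrable ?M (\<lambda>\<omega>. \<Sum>e\<in>E. indicator (?S e) \<omega> :: real)"
    using S by (intro Bochner_Integration.integrable_sum) (auto simp: emeasure_eq_measure)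
  show "integrable ?M (\<lambda>\<omega>. real (card (output_edges A V E port \<omega>)))"
    using int by (rule Bochner_Integration.integrable_cong[THEN iffD2, rotated -1]) (auto simp: eq)
  have "expected_output_size A V E port = (\<integral>\<omega>. (\<Sum>e\<in>E. indicator (?S e) \<omega>) \<partial>?M)"
    unfolding expected_output_size_def by (intro Bochner_Integration.integral_cong refl eq)
  also have "\<dots> = (\<Sum>e\<in>E. \<integral>\<omega>. indicator (?S e) \<omega> \<partial>?M)"
    using S by (intro Bochner_Integration.integral_sum) (auto simp: emeasure_eq_measure)
  also have "\<dots> = (\<Sum>e\<in>E. measure ?M (?S e))"
    using S by (intro sum.cong refl) (simp add: sets.Int_space_eq1 Int_absorb1)
  finally show "expected_output_size A V E port = (\<Sum>e\<in>E. measure ?M (?S e))" .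
qed

text \<open>Colour the vertices by membership in one side of the cut: the monochromatic edges do not
  cross it.\<close>

lemma expected_output_size_le:
  assumes fin: "finite E" and cut: "outputs_cut A V E port"
    and mono: "\<And>col :: nat \<Rightarrow> bool. b \<le> card {e \<in> E. \<exists>c. \<forall>p\<in>e. col p = c}"
  shows "expected_output_size A V E port \<le> real (card E) - real b"
proof -
  let ?M = "tapes_measure V"
  interpret prob_space ?M
    unfolding tapes_measure_def tape_measure_def
    by (intro prob_space_PiM prob_space_measure_pmf)
  have card_cut: "card F \<le> card E - b" if "is_cut V E F" for F
  proof -
    obtain S T where ST: "S \<union> T = V" "S \<inter> T = {}" "F = crossing_edges E S T"
      using \<open>is_cut V E F\<close> by (auto simp: is_cut_def)
    let ?B = "{e \<in> E. \<exists>c. \<forall>p\<in>e. (p \<in> S) = c}"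
    have "F \<subseteq> E - ?B" using ST unfolding crossing_edges_def by blast
    then have "card F \<le> card (E - ?B)" using fin by (intro card_mono) auto
    also have "\<dots> = card E - card ?B" using fin by (intro card_Diff_subset) auto
    also have "\<dots> \<le> card E - b" using mono[of "\<lambda>p. p \<in> S"] by (rule diff_le_mono2)
    finally show ?thesis .
  qed
  have "b \<le> card E"
    using mono[of "\<lambda>_. True"] card_mono[OF fin, of "{e \<in> E. \<exists>c. \<forall>p\<in>e. True = c}"] by auto
  then have le: "real (card F) \<le> real (card E) - real b" if "is_cut V E F" for F
    using card_cut[OF that] by linarith
  have "AE \<omega> in ?M. real (card (output_edges A V E port \<omega>)) \<le> real (card E) - real b"
    using cut unfolding outputs_cut_def by (auto elim: eventually_mono intro: le)
  then show ?thesis unfolding expected_output_size_def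
    by (intro integral_le_const integral_tapes_card_output(1)[OF fin cut])
qed

lemma sum_oriented_edges:
  fixes F :: "'a set \<Rightarrow> 'b :: comm_semiring_1"
  assumes fin: "finite {(p, q). L p q}" and sym: "\<And>p q. L p q \<Longrightarrow> L q p" and irr: "\<And>p. \<not> L p p"
  shows "(\<Sum>(p, q)\<in>{(p, q). L p q}. F {p, q}) = 2 * (\<Sum>e\<in>{{p, q} |p q. L p q}. F e)"
proof -
  have E: "{{p, q} |p q. L p q} = (\<lambda>(p, q). {p, q}) ` {(p, q). L p q}" by auto
  have "(\<Sum>(p, q)\<in>{(p, q). L p q}. F {p, q}) =
    (\<Sum>e\<in>{{p, q} |p q. L p q}. \<Sum>pq\<in>{pq \<in> {(p, q). L p q}. (\<lambda>(p, q). {p, q}) pq = e}. (\<lambda>(p, q). F {p, q}) pq)"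
    by (rule sum.group[symmetric]) (use fin in \<open>auto simp: E\<close>)
  also have "\<dots> = (\<Sum>e\<in>{{p, q} |p q. L p q}. 2 * F e)"
  proof (rule sum.cong[OF refl])
    fix e assume "e \<in> {{p, q} |p q. L p q}"
    then obtain p q where pq: "e = {p, q}" "L p q" by blast
    then have "p \<noteq> q" using irr by blast
    have "{pq \<in> {(p, q). L p q}. (\<lambda>(p, q). {p, q}) pq = e} = {(p, q), (q, p)}"
      using pq sym by (auto simp: doubleton_eq_iff)
    then show "(\<Sum>pq\<in>{pq \<in> {(p, q). L p q}. (\<lambda>(p, q). {p, q}) pq = e}. (\<lambda>(p, q). F {p, q}) pq) = 2 * F e"
      using \<open>p \<noteq> q\<close> pq(1) by (simp add: insert_commute mult_2)
  qed
  finally show ?thesis by (simp add: sum_distrib_left)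
qed

section \<open>Twisted two-fold lifts of a regular graph\<close>

text \<open>
  Both graphs of the indistinguishability argument have vertex set \<open>{..<2 * n}\<close>, with two vertices
  over each \<open>x < n\<close>. An edge over \<open>x, y\<close> switches sides iff \<open>\<tau> x\<close>. Loops at \<open>x\<close> in \<open>adj\<close> are
  harmless if \<open>\<tau> x\<close>: they become edges between the two vertices over \<open>x\<close>.
\<close>

definition lift_adj :: "(nat \<Rightarrow> nat \<Rightarrow> bool) \<Rightarrow> (nat \<Rightarrow> bool) \<Rightarrow> nat \<Rightarrow> nat \<Rightarrow> bool" where
  "lift_adj adj \<tau> p q \<longleftrightarrow> adj (under p) (under q) \<and> side q = (side p \<noteq> \<tau> (under p))"

definition lift_edges :: "(nat \<Rightarrow> nat \<Rightarrow> bool) \<Rightarrow> (nat \<Rightarrow> bool) \<Rightarrow> nat set set" where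
  "lift_edges adj \<tau> = {{p, q} |p q. lift_adj adj \<tau> p q}"

text \<open>\<open>twist_cong\<close> makes the lift symmetric and \<open>twist_loop\<close> keeps
  it free of loops. A loop counts once in the degree, since it lifts to a single edge.\<close>

locale lifted_graph =
  fixes n :: nat and adj :: "nat \<Rightarrow> nat \<Rightarrow> bool" and \<tau> :: "nat \<Rightarrow> bool"
  assumes dom: "adj x y \<Longrightarrow> x < n"
    and sym: "adj x y \<Longrightarrow> adj y x"
    and deg: "x < n \<Longrightarrow> card {y. adj x y} = 18"
    and twist_cong: "adj x y \<Longrightarrow> \<tau> x = \<tau> y"
    and twist_loop: "adj x x \<Longrightarrow> \<tau> x"
begin

lemma lift_sym:
  assumes "lift_adj adj \<tau> p q"
  shows "lift_adj adj \<tau> q p"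
proof -
  have a: "adj (under p) (under q)" "side q = (side p \<noteq> \<tau> (under p))"
    using assms by (simp_all add: lift_adj_def)
  show ?thesis unfolding lift_adj_def using sym[OF a(1)] twist_cong[OF a(1)] a(2) by blast
qed

lemma lift_irrefl: "\<not> lift_adj adj \<tau> p p"
  unfolding lift_adj_def using twist_loop by blast

lemma lift_dom: "lift_adj adj \<tau> p q \<Longrightarrow> p < 2 * n \<and> q < 2 * n"
  unfolding lift_adj_def under_less using dom sym by blast

lemma mem_lift_edges: "{p, q} \<in> lift_edges adj \<tau> \<longleftrightarrow> lift_adj adj \<tau> p q"
  unfolding lift_edges_def mem_Collect_eq doubleton_eq_iff using lift_sym by blast

lemma finite_lift_pairs: "finite {(p, q). lift_adj adj \<tau> p q \<and> P p q}"
  by (rule finite_subset[of _ "{..<2 * n} \<times> {..<2 * n}"]) (use lift_dom in auto)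

lemma finite_lift_edges: "finite (lift_edges adj \<tau>)"
  by (rule finite_subset[of _ "Pow {..<2 * n}"]) (use lift_dom in \<open>auto simp: lift_edges_def\<close>)

lemma neighbours_lift: "neighbours (lift_edges adj \<tau>) p = {q. lift_adj adj \<tau> p q}"
  unfolding neighbours_def mem_lift_edges using lift_sym lift_irrefl by blast

lemma neighbours_lift_image:
  "{q. lift_adj adj \<tau> p q} = (\<lambda>y. vtx y (side p \<noteq> \<tau> (under p))) ` {y. adj (under p) y}"
proof (intro set_eqI iffI)
  fix q assume "q \<in> {q. lift_adj adj \<tau> p q}"
  then have "adj (under p) (under q)" "q = vtx (under q) (side p \<noteq> \<tau> (under p))"
    by (auto simp: lift_adj_def intro: vtx_eqI)
  then show "q \<in> (\<lambda>y. vtx y (side p \<noteq> \<tau> (under p))) ` {y. adj (under p) y}" by blast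
qed (auto simp: lift_adj_def)

lemma lift_bij: "bij_betw under (neighbours (lift_edges adj \<tau>) p) {y. adj (under p) y}"
  unfolding neighbours_lift neighbours_lift_image
  by (rule bij_betw_byWitness[of _ "\<lambda>y. vtx y (side p \<noteq> \<tau> (under p))"]) auto

lemma lift_degree: "p < 2 * n \<Longrightarrow> vertex_degree (lift_edges adj \<tau>) p = 18"
  using bij_betw_same_card[OF lift_bij] deg by (simp add: vertex_degree_def under_less)

lemma lift_regular: "regular_graph 18 {..<2 * n} (lift_edges adj \<tau>)"
proof -
  have "card e = 2 \<and> e \<subseteq> {..<2 * n}" if "e \<in> lift_edges adj \<tau>" for e
  proof -
    obtain p q where "e = {p, q}" "lift_adj adj \<tau> p q"
      using \<open>e \<in> lift_edges adj \<tau>\<close> unfolding lift_edges_def by blast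
    moreover from this have "p \<noteq> q" using lift_irrefl by blast
    ultimately show ?thesis using lift_dom by auto
  qed
  then show ?thesis using lift_degree by (auto simp: regular_graph_def simple_graph_def)
qed

lemma lift_port_numbering:
  assumes "\<And>x. x < n \<Longrightarrow> bij_betw (\<pi> x) {y. adj x y} {..<18}"
  shows "port_numbering {..<2 * n} (lift_edges adj \<tau>) (\<lambda>p q. \<pi> (under p) (under q))"
  unfolding port_numbering_def
proof
  fix p assume "p \<in> {..<2 * n}"
  then show "bij_betw (\<lambda>q. \<pi> (under p) (under q)) (neighbours (lift_edges adj \<tau>) p)
      {..<vertex_degree (lift_edges adj \<tau>) p}"
    using bij_betw_trans[OF lift_bij assms[of "under p"]] lift_degree[of p]
    by (simp add: o_def under_less)
qed

lemma sum_lift_edges: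
  fixes F :: "nat set \<Rightarrow> 'b :: comm_semiring_1"
  shows "(\<Sum>(p, q)\<in>{(p, q). lift_adj adj \<tau> p q}. F {p, q}) = 2 * (\<Sum>e\<in>lift_edges adj \<tau>. F e)"
  unfolding lift_edges_def
  using sum_oriented_edges[of "lift_adj adj \<tau>" F] finite_lift_pairs[of "\<lambda>_ _. True"] lift_sym lift_irrefl
  by simp

lemma card_lift_edges: "card (lift_edges adj \<tau>) = 18 * n"
proof -
  have "2 * card (lift_edges adj \<tau>) = card {(p, q). lift_adj adj \<tau> p q}"
    using sum_lift_edges[of "\<lambda>_. 1 :: nat"] by (simp add: case_prod_unfold)
  also have "{(p, q). lift_adj adj \<tau> p q} = (SIGMA p:{..<2 * n}. {q. lift_adj adj \<tau> p q})"
    using lift_dom by auto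
  also have "card \<dots> = (\<Sum>p<2 * n. card {q. lift_adj adj \<tau> p q})"
    by (intro card_SigmaI) (auto intro: finite_subset[of _ "{..<2 * n}"] dest: lift_dom)
  also have "\<dots> = (\<Sum>p<2 * n. 18)"
    using lift_degree by (intro sum.cong) (auto simp: vertex_degree_def neighbours_lift)
  finally show ?thesis by simp
qed

lemma mem_output_lift:
  assumes "lift_adj adj \<tau> p q"
  shows "{p, q} \<in> output_edges A V (lift_edges adj \<tau>) port \<omega> \<longleftrightarrow>
    edge_decision A {(state_after A V (lift_edges adj \<tau>) port \<omega> (rounds A (card V)) p, port p q),
      (state_after A V (lift_edges adj \<tau>) port \<omega> (rounds A (card V)) q, port q p)}"
proof -
  let ?st = "state_after A V (lift_edges adj \<tau>) port \<omega> (rounds A (card V))"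
  let ?D = "\<lambda>u v. edge_decision A {(?st u, port u v), (?st v, port v u)}"
  show ?thesis unfolding output_edges_def Let_def mem_Collect_eq
  proof
    assume "\<exists>u v. {p, q} = {u, v} \<and> {u, v} \<in> lift_edges adj \<tau> \<and> ?D u v"
    then obtain u v where uv: "{p, q} = {u, v}" "?D u v" by blast
    then consider "u = p" "v = q" | "u = q" "v = p" by (auto simp: doubleton_eq_iff)
    then show "?D p q" using uv(2) by cases (simp_all only: insert_commute)
  next
    assume "?D p q"
    moreover have "{p, q} \<in> lift_edges adj \<tau>" using assms by (simp only: mem_lift_edges)
    ultimately show "\<exists>u v. {p, q} = {u, v} \<and> {u, v} \<in> lift_edges adj \<tau> \<and> ?D u v" by blast
  qed
qed

end

lemma bipartite_double_cover:
  assumes "lifted_graph n adj (\<lambda>_. True)"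
  shows "bipartite {..<2 * n} (lift_edges adj (\<lambda>_. True))"
proof -
  interpret lifted_graph n adj "\<lambda>_. True" by (rule assms)
  let ?S = "{p. p < 2 * n \<and> side p}" and ?T = "{p. p < 2 * n \<and> \<not> side p}"
  have "e \<inter> ?S \<noteq> {} \<and> e \<inter> ?T \<noteq> {}" if "e \<in> lift_edges adj (\<lambda>_. True)" for e
  proof -
    obtain p q where e: "e = {p, q}" and l: "lift_adj adj (\<lambda>_. True) p q"
      using \<open>e \<in> lift_edges adj (\<lambda>_. True)\<close> unfolding lift_edges_def by blast
    have "side q = (\<not> side p)" using l by (simp add: lift_adj_def)
    then show ?thesis using lift_dom[OF l] by (cases "side p") (auto simp: e)
  qed
  then have "crossing_edges (lift_edges adj (\<lambda>_. True)) ?S ?T = lift_edges adj (\<lambda>_. True)"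
    unfolding crossing_edges_def by blast
  moreover have "?S \<union> ?T = {..<2 * n}" "?S \<inter> ?T = {}" by blast+
  ultimately show ?thesis unfolding bipartite_def by (intro exI conjI)
qed

text \<open>The tapes are independent and identically distributed, so permuting them among the
  vertices preserves their law.\<close>

lemma tapes_measure_permute:
  assumes inj: "inj_on \<sigma> V" and im: "\<sigma> ` V \<subseteq> V"
    and S: "{\<omega> \<in> space (tapes_measure V). P \<omega>} \<in> sets (tapes_measure V)"
  shows "measure (tapes_measure V) {\<omega> \<in> space (tapes_measure V). P \<omega>} =
    measure (tapes_measure V) {\<omega> \<in> space (tapes_measure V). P (\<lambda>p\<in>V. \<omega> (\<sigma> p))}"
proof -
  let ?M = "tapes_measure V"
  let ?f = "\<lambda>\<omega>. \<lambda>p\<in>V. \<omega> (\<sigma> p)"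
  have M: "?M = Pi\<^sub>M V (\<lambda>_. tape_measure)" by (rule tapes_measure_def)
  have ps: "prob_space tape_measure"
    unfolding tape_measure_def by (intro prob_space_PiM prob_space_measure_pmf)
  have distr: "distr ?M ?M ?f = ?M"
    unfolding M using distr_PiM_reindex[of V "\<lambda>_. tape_measure" \<sigma> V] ps inj im by auto
  have meas: "?f \<in> measurable ?M ?M"
    unfolding M using im by (intro measurable_restrict measurable_component_singleton) auto
  have "measure ?M {\<omega> \<in> space ?M. P \<omega>} = measure (distr ?M ?M ?f) {\<omega> \<in> space ?M. P \<omega>}"
    by (simp only: distr)
  also have "\<dots> = measure ?M (?f -` {\<omega> \<in> space ?M. P \<omega>} \<inter> space ?M)"
    by (rule measure_distr[OF meas S])
  also have "?f -` {\<omega> \<in> space ?M. P \<omega>} \<inter> space ?M = {\<omega> \<in> space ?M. P (?f \<omega>)}"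
    using measurable_space[OF meas] by auto
  finally show ?thesis .
qed

section \<open>Coupling the double cover with two copies\<close>

text \<open>
  With \<open>\<tau> = (\<lambda>_. True)\<close> the lift is the double cover; with \<open>\<tau> = (\<lambda>x. x \<in> Z)\<close> it is two copies of the
  graph outside \<open>Z\<close> and again the double cover on \<open>Z\<close>, where both graphs agree. Flipping sides according
  to a local two-colouring \<open>s\<close> is a permutation of the vertices that maps balls of the former graph
  to balls of the latter.
\<close>

definition flip :: "(nat \<Rightarrow> bool) \<Rightarrow> nat \<Rightarrow> nat" where
  "flip s p = vtx (under p) (side p \<noteq> s (under p))"

lemma flip_simps [simp]: "under (flip s p) = under p" "side (flip s p) = (side p \<noteq> s (under p))"
  by (simp_all add: flip_def)

lemma flip_flip [simp]: "flip s (flip s p) = p"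
  unfolding flip_def[of s "flip s p"] by (rule vtx_eqI[symmetric]) auto

text \<open>The two twists differ at \<open>x\<close> iff \<open>x \<notin> Z\<close>. By
  \<open>local_switch\<close> this difference is, up to distance \<open>T\<close> from
  \<open>u\<close>, the coboundary of \<open>s\<close>, so \<open>flip s\<close> identifies the two
  lifts there.\<close>

locale switched_graph = double: lifted_graph n adj "\<lambda>_. True" + copies: lifted_graph n adj "\<lambda>x. x \<in> Z"
  for n adj Z +
  fixes T :: nat and \<pi> :: "nat \<Rightarrow> nat \<Rightarrow> nat"
  assumes local_switch: "u < n \<Longrightarrow> \<exists>(d :: nat \<Rightarrow> nat) (s :: nat \<Rightarrow> bool). d u = 0 \<and>
      (\<forall>x y. adj x y \<longrightarrow> d y \<le> Suc (d x)) \<and>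
      (\<forall>x y. adj x y \<longrightarrow> d x \<le> T \<longrightarrow> (s x \<noteq> s y) = (x \<notin> Z))"
    and port_bij: "x < n \<Longrightarrow> bij_betw (\<pi> x) {y. adj x y} {..<18}"
begin

abbreviation "V \<equiv> {..<2 * n}"
abbreviation "EG \<equiv> lift_edges adj (\<lambda>_. True)"
abbreviation "EH \<equiv> lift_edges adj (\<lambda>x. x \<in> Z)"
abbreviation "port \<equiv> \<lambda>p q. \<pi> (under p) (under q)"

text \<open>Each round looks one edge further, so the budget \<open>d (under p) + i\<close> is kept
  when a round is traded for a step. The bound is \<open>Suc T\<close> because a vertex that still
  has a round to undo satisfies \<open>d \<le> T\<close>, where its edges match; thus
  \<open>T\<close> rounds are covered at \<open>u\<close> and at its neighbours, hence at both ends
  of an edge.\<close>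

lemma state_after_flip:
  assumes lip: "\<And>x y. adj x y \<Longrightarrow> d y \<le> Suc (d x)"
    and s: "\<And>x y. adj x y \<Longrightarrow> d x \<le> T \<Longrightarrow> (s x \<noteq> s y) = (x \<notin> Z)"
  shows "p < 2 * n \<Longrightarrow> d (under p) + i \<le> Suc T \<Longrightarrow>
    state_after A V EG port (\<lambda>p\<in>V. \<omega> (flip s p)) i p = state_after A V EH port \<omega> i (flip s p)"
proof (induction i arbitrary: p)
  case 0
  then have "flip s p < 2 * n" by (simp add: under_less)
  then show ?case using 0 by (simp add: double.lift_degree copies.lift_degree)
next
  case (Suc i)
  let ?sG = "state_after A V EG port (\<lambda>p\<in>V. \<omega> (flip s p)) i"
  let ?sH = "state_after A V EH port \<omega> i"
  have nb: "neighbours EH (flip s p) = flip s ` neighbours EG p"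
  proof -
    have "lift_adj adj (\<lambda>x. x \<in> Z) (flip s p) (flip s q) \<longleftrightarrow> lift_adj adj (\<lambda>_. True) p q" for q
      using s[of "under p" "under q"] Suc.prems(2) by (auto simp: lift_adj_def)
    then show ?thesis
      unfolding copies.neighbours_lift double.neighbours_lift
      by (auto simp: image_iff) (metis flip_flip)
  qed
  have IH: "?sG q = ?sH (flip s q)" if "q \<in> neighbours EG p" for q
  proof (rule Suc.IH)
    have l: "lift_adj adj (\<lambda>_. True) p q" using that by (simp add: double.neighbours_lift)
    then show "q < 2 * n" using double.lift_dom by blast
    show "d (under q) + i \<le> Suc T"
      using lip[of "under p" "under q"] l Suc.prems(2) by (simp add: lift_adj_def)
  qed
  then have "{(port p u, send A (?sG u) (port u p)) |u. u \<in> neighbours EG p} =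
    {(port (flip s p) u, send A (?sH u) (port u (flip s p))) |u. u \<in> neighbours EH (flip s p)}"
    unfolding nb Setcompr_eq_image image_image by (intro image_cong refl) (simp add: IH)
  moreover have "?sG p = ?sH (flip s p)" by (rule Suc.IH) (use Suc.prems in auto)
  ultimately show ?case by (simp only: state_after.simps)
qed

lemma edge_probability_eq:
  assumes pq: "lift_adj adj (\<lambda>_. True) p q" and rounds: "rounds A (2 * n) \<le> T"
    and cut: "outputs_cut A V EG port"
  shows "measure (tapes_measure V) {\<omega> \<in> space (tapes_measure V). {p, q} \<in> output_edges A V EG port \<omega>} =
    measure (tapes_measure V) {\<omega> \<in> space (tapes_measure V).
      {p, vtx (under q) (side p \<noteq> (under p \<in> Z))} \<in> output_edges A V EH port \<omega>}"
proof -
  have a: "adj (under p) (under q)" "p < 2 * n" "q < 2 * n" "side q = (\<not> side p)"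
    using pq double.lift_dom by (auto simp: lift_adj_def)
  then obtain d :: "nat \<Rightarrow> nat" and s0 :: "nat \<Rightarrow> bool" where d: "d (under p) = 0"
    "\<And>x y. adj x y \<Longrightarrow> d y \<le> Suc (d x)"
    and s0: "\<And>x y. adj x y \<Longrightarrow> d x \<le> T \<Longrightarrow> (s0 x \<noteq> s0 y) = (x \<notin> Z)"
    using local_switch[of "under p"] by (auto simp: under_less)
  \<comment> \<open>Normalized to be \<open>False\<close> below \<open>p\<close>, so that
    \<open>flip s\<close> fixes \<open>p\<close>; complementing a colouring does not change where it
    switches.\<close>
  define s where "s x = (s0 x \<noteq> s0 (under p))" for x
  have s: "(s x \<noteq> s y) = (x \<notin> Z)" if "adj x y" "d x \<le> T" for x y
    using s0[OF that] by (auto simp: s_def)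
  have sp: "flip s p = p" unfolding flip_def by (rule vtx_eqI[symmetric]) (auto simp: s_def)
  let ?q = "vtx (under q) (side p \<noteq> (under p \<in> Z))"
  have sq: "flip s q = ?q"
    using s[OF a(1)] d(1) a(4) by (auto simp: flip_def s_def)
  have pq': "lift_adj adj (\<lambda>x. x \<in> Z) p ?q" using a by (simp add: lift_adj_def)
  have st: "state_after A V EG port (\<lambda>p\<in>V. \<omega> (flip s p)) (rounds A (2 * n)) r =
    state_after A V EH port \<omega> (rounds A (2 * n)) (flip s r)" if "r \<in> {p, q}" for r \<omega>
    by (rule state_after_flip[OF d(2) s]) (use that a rounds d(1) d(2)[OF a(1)] in auto)
  have "{p, q} \<in> output_edges A V EG port (\<lambda>p\<in>V. \<omega> (flip s p)) \<longleftrightarrow>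
    {p, ?q} \<in> output_edges A V EH port \<omega>" for \<omega>
    unfolding double.mem_output_lift[OF pq] copies.mem_output_lift[OF pq']
    using st[of p \<omega>] st[of q \<omega>] by (simp add: sp sq)
  moreover have "{\<omega> \<in> space (tapes_measure V). {p, q} \<in> output_edges A V EG port \<omega>} \<in> sets (tapes_measure V)"
    using cut pq by (auto simp: outputs_cut_def double.mem_lift_edges)
  moreover have "inj_on (flip s) V" by (metis flip_flip inj_onI)
  moreover have "flip s ` V \<subseteq> V" by (auto simp: under_less)
  ultimately show ?thesis
    using tapes_measure_permute[of "flip s" V "\<lambda>\<omega>. {p, q} \<in> output_edges A V EG port \<omega>"] by simp
qed

lemma expected_output_size_eq:
  assumes rounds: "rounds A (2 * n) \<le> T"
    and cutG: "outputs_cut A V EG port" and cutH: "outputs_cut A V EH port"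
  shows "expected_output_size A V EG port = expected_output_size A V EH port"
proof -
  let ?P = "\<lambda>E e. measure (tapes_measure V) {\<omega> \<in> space (tapes_measure V). e \<in> output_edges A V E port \<omega>}"
  let ?LG = "{(p, q). lift_adj adj (\<lambda>_. True) p q}" and ?LH = "{(p, q). lift_adj adj (\<lambda>x. x \<in> Z) p q}"
  \<comment> \<open>The first vertex stays, the second moves to the sheet that the twist of the
    other lift prescribes.\<close>
  let ?h = "\<lambda>(p, q). (p, vtx (under q) (side p \<noteq> (under p \<in> Z)))"
  have bij: "bij_betw ?h ?LG ?LH"
    by (rule bij_betw_byWitness[of _ "\<lambda>(p, q). (p, vtx (under q) (\<not> side p))"])
      (auto simp: lift_adj_def intro!: vtx_eqI[symmetric])
  have "2 * expected_output_size A V EG port = (\<Sum>(p, q)\<in>?LG. ?P EG {p, q})"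
    unfolding integral_tapes_card_output(2)[OF double.finite_lift_edges cutG]
    by (rule double.sum_lift_edges[of "?P EG", symmetric])
  also have "\<dots> = (\<Sum>pq\<in>?LG. (\<lambda>(p, q). ?P EH {p, q}) (?h pq))"
    by (intro sum.cong refl) (auto simp: edge_probability_eq[OF _ rounds cutG])
  also have "\<dots> = (\<Sum>(p, q)\<in>?LH. ?P EH {p, q})" by (rule sum.reindex_bij_betw[OF bij])
  also have "\<dots> = 2 * expected_output_size A V EH port"
    unfolding integral_tapes_card_output(2)[OF copies.finite_lift_edges cutH]
    by (rule copies.sum_lift_edges[of "?P EH"])
  finally show ?thesis by simp
qed

text \<open>Each of the two sheets outside \<open>Z\<close> contributes \<open>b\<close> ordered
  pairs, and each edge accounts for two of them.\<close>

lemma monochromatic_copies: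
  assumes lower: "\<And>col :: nat \<Rightarrow> bool. b \<le> card {(x, y). adj x y \<and> x \<notin> Z \<and> col x = col y}"
  shows "b \<le> card {e \<in> EH. \<exists>c. \<forall>p\<in>e. col p = (c :: bool)}"
proof -
  let ?m = "\<lambda>c. {(x, y). adj x y \<and> x \<notin> Z \<and> col (vtx x c) = col (vtx y c)}"
  let ?L = "{(p, q). lift_adj adj (\<lambda>x. x \<in> Z) p q \<and> col p = col q}"
  let ?F = "\<lambda>(c, x, y). (vtx x c, vtx y c)"
  have fin: "finite (?m c)" for c
    by (rule finite_subset[of _ "{..<n} \<times> {..<n}"]) (use copies.dom copies.sym in auto)
  have "2 * b \<le> (\<Sum>c\<in>UNIV. card (?m c))"
    using lower[of "\<lambda>x. col (vtx x True)"] lower[of "\<lambda>x. col (vtx x False)"] by (simp add: UNIV_bool)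
  also have "\<dots> = card (SIGMA c:UNIV. ?m c)" using fin by (simp add: card_SigmaI)
  also have "\<dots> \<le> card ?L"
  proof (rule card_inj_on_le[where f = ?F])
    show "inj_on ?F (SIGMA c:UNIV. ?m c)" by (auto simp: inj_on_def)
    show "?F ` (SIGMA c:UNIV. ?m c) \<subseteq> ?L" by (auto simp: lift_adj_def)
    show "finite ?L" by (rule copies.finite_lift_pairs)
  qed
  also have "card ?L = (\<Sum>(p, q)\<in>{(p, q). lift_adj adj (\<lambda>x. x \<in> Z) p q}. of_bool (\<exists>c. \<forall>r\<in>{p, q}. col r = c))"
  proof -
    have "?L = {pq \<in> {(p, q). lift_adj adj (\<lambda>x. x \<in> Z) p q}. (\<lambda>(p, q). \<exists>c. \<forall>r\<in>{p, q}. col r = c) pq}"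
      by auto
    then show ?thesis using copies.finite_lift_pairs[of "\<lambda>_ _. True"]
      by (simp add: sum_of_bool_eq case_prod_unfold Int_def)
  qed
  also have "\<dots> = 2 * (\<Sum>e\<in>EH. of_bool (\<exists>c. \<forall>r\<in>e. col r = c))"
    by (rule copies.sum_lift_edges[of "\<lambda>e. of_bool (\<exists>c. \<forall>r\<in>e. col r = c)"])
  also have "(\<Sum>e\<in>EH. of_bool (\<exists>c. \<forall>r\<in>e. col r = c)) = card {e \<in> EH. \<exists>c. \<forall>r\<in>e. col r = c}"
    using copies.finite_lift_edges by (simp add: Int_def)
  finally show ?thesis by simp
qed

text \<open>The approximation guarantee is applied to the double cover, the demand that the output
  be a cut to the copies as well. Both graphs have \<open>18 * n\<close> edges and the same expected
  output.\<close>

lemma approximation_bound: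
  assumes A: "approximates_bipartite_max_cut 18 \<epsilon> A" and rounds: "rounds A (2 * n) \<le> T"
    and lower: "\<And>col :: nat \<Rightarrow> bool. b \<le> card {(x, y). adj x y \<and> x \<notin> Z \<and> col x = col y}"
  shows "real b \<le> \<epsilon> * (18 * n)"
proof -
  have cuts: "outputs_cut A V EG port" "outputs_cut A V EH port"
    using A double.lift_regular copies.lift_regular double.lift_port_numbering[OF port_bij]
      copies.lift_port_numbering[OF port_bij]
    unfolding approximates_bipartite_max_cut_def by blast+
  have "(1 - \<epsilon>) * real (card EG) \<le> expected_output_size A V EG port"
    using A double.lift_regular double.lift_port_numbering[OF port_bij]
      bipartite_double_cover[OF double.lifted_graph_axioms]
    unfolding approximates_bipartite_max_cut_def by blast
  also have "\<dots> = expected_output_size A V EH port"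
    by (rule expected_output_size_eq[OF rounds cuts])
  also have "\<dots> \<le> real (card EH) - real b"
    by (rule expected_output_size_le[OF copies.finite_lift_edges cuts(2) monochromatic_copies[OF lower]])
  finally show ?thesis
    by (simp add: double.card_lift_edges copies.card_lift_edges algebra_simps)
qed

end

subsection \<open>The lower bound\<close>

text \<open>The core \<open>{..<h}\<close> carries the regularized subdivision, and the remaining
  \<open>r\<close> vertices form \<open>Z\<close>. The number \<open>(m + 4) div 5\<close> is
  \<open>m / 5\<close> rounded up.\<close>

lemma exists_switched_graph:
  assumes m: "200 \<le> m" and R: "100 * 6 ^ (2 * R + 3) \<le> m"
    and n: "36 * (m * (1 + 18 * k)) + 18 \<le> n"
  shows "\<exists>adj Z \<pi>. switched_graph n adj Z ((2 * k + 1) * R) \<pi> \<and>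
    (\<forall>col :: nat \<Rightarrow> bool. 36 * ((m + 4) div 5) \<le> card {(x, y). adj x y \<and> x \<notin> Z \<and> col x = col y})"
proof -
  obtain adj0 :: "nat \<Rightarrow> nat \<Rightarrow> bool" where base: "graph_on {..<m} adj0"
    "\<And>x. card {y. adj0 x y} \<le> 18" "locally_bipartite {..<m} adj0 R"
    "\<And>col. m \<le> 5 * card (mono_pairs adj0 col)"
    by (rule exists_base_graph[OF m R]) (rule that)
  have base_mono: "(m + 4) div 5 \<le> card (mono_pairs adj0 col)" for col
    using base(4)[of col] by linarith
  obtain h and adj1 :: "nat \<Rightarrow> nat \<Rightarrow> bool" where h: "h \<le> 36 * (card {..<m} * (1 + 18 * k))"
    and g: "graph_on {..<h} adj1" and deg: "\<And>x. x < h \<Longrightarrow> card {y. adj1 x y} = 18"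
    and lb: "locally_bipartite {..<h} adj1 ((2 * k + 1) * R)"
    and mono: "\<And>col. 36 * ((m + 4) div 5) \<le> card (mono_pairs adj1 col)"
    by (rule subdivided_regular_graph[OF base(1) base(2) base(3) base_mono, of k]) (rule that)
  define r where "r = n - h"
  have r: "18 \<le> r" "n = h + r" using h n by (simp_all add: r_def)
  define Z where "Z = {h..}"
  \<comment> \<open>On \<open>Z\<close> a rule depending on the sum modulo \<open>r\<close> is
    symmetric and gives degree 18 as \<open>r\<close> is at least 18. It may create loops, which the
    twist on \<open>Z\<close> permits.\<close>
  define adj where "adj x y \<longleftrightarrow> adj1 x y \<or>
    (h \<le> x \<and> h \<le> y \<and> x < n \<and> y < n \<and> ((x - h) + (y - h)) mod r < 18)" for x y
  have adj1: "x < h" "y < h" "adj1 y x" "x \<noteq> y" if "adj1 x y" for x y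
    using g that unfolding graph_on_def by blast+
  have cases_adj: "(adj1 x y \<Longrightarrow> x < h \<Longrightarrow> y < h \<Longrightarrow> P) \<Longrightarrow> (h \<le> x \<Longrightarrow> h \<le> y \<Longrightarrow> P) \<Longrightarrow> P"
    if "adj x y" for x y P
    using that adj1(1,2)[of x y] unfolding adj_def by blast
  have dom: "x < n" if "adj x y" for x y
    using that adj1(1)[of x y] r unfolding adj_def by linarith
  have sym: "adj y x" if "adj x y" for x y
    using that adj1(3)[of x y] unfolding adj_def by (metis add.commute)
  have Zeq: "x \<in> Z \<longleftrightarrow> y \<in> Z" if "adj x y" for x y
    by (rule cases_adj[OF that]) (simp_all add: Z_def)
  have Zloop: "x \<in> Z" if "adj x x" for x
    by (rule cases_adj[OF that]) (use adj1(4)[of x x] in \<open>simp_all add: Z_def\<close>)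
  have degree: "card {y. adj x y} = 18" if "x < n" for x
  proof (cases "x < h")
    case True
    then have "{y. adj x y} = {y. adj1 x y}" by (auto simp: adj_def)
    then show ?thesis using deg[OF True] by simp
  next
    case False
    have "{y. adj x y} = (\<lambda>j. h + j) ` {j. j < r \<and> ((x - h) + j) mod r < 18}"
    proof (intro set_eqI iffI)
      fix y assume "y \<in> {y. adj x y}"
      then have "h \<le> y" "y < n" "((x - h) + (y - h)) mod r < 18"
        using False adj1(1)[of x y] by (auto simp: adj_def)
      then show "y \<in> (\<lambda>j. h + j) ` {j. j < r \<and> ((x - h) + j) mod r < 18}"
        using r(2) by (intro image_eqI[of _ _ "y - h"]) auto
    qed (use False that r in \<open>auto simp: adj_def\<close>)
    then show ?thesis
      using card_shift_mod[of 18 r "x - h"] r by (simp add: card_image)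
  qed
  have switch: "\<exists>(d :: nat \<Rightarrow> nat) (s :: nat \<Rightarrow> bool). d u = 0 \<and>
      (\<forall>x y. adj x y \<longrightarrow> d y \<le> Suc (d x)) \<and>
      (\<forall>x y. adj x y \<longrightarrow> d x \<le> (2 * k + 1) * R \<longrightarrow> (s x \<noteq> s y) = (x \<notin> Z))" if "u < n" for u
  proof (cases "u < h")
    case True
    then obtain d :: "nat \<Rightarrow> nat" and s :: "nat \<Rightarrow> bool" where ds: "d u = 0"
      "\<And>x y. adj1 x y \<Longrightarrow> d y \<le> Suc (d x)"
      "\<And>x y. adj1 x y \<Longrightarrow> d x \<le> (2 * k + 1) * R \<Longrightarrow> s x \<noteq> s y"
      using lb unfolding locally_bipartite_def by (metis lessThan_iff)
    show ?thesis
    \<comment> \<open>No edge joins the core to \<open>Z\<close>, so any constants serve on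
      \<open>Z\<close>; a constant colour is what \<open>x \<in> Z\<close> demands.\<close>
    proof (rule exI[of _ "\<lambda>x. if x < h then d x else 0"], rule exI[of _ "\<lambda>x. x < h \<and> s x"],
        intro conjI allI impI)
      fix x y assume xy: "adj x y"
      note c = cases_adj[OF xy]
      show "(if y < h then d y else 0) \<le> Suc (if x < h then d x else 0)"
        by (rule c) (use ds(2)[of x y] in auto)
      assume le: "(if x < h then d x else 0) \<le> (2 * k + 1) * R"
      show "((x < h \<and> s x) \<noteq> (y < h \<and> s y)) = (x \<notin> Z)"
        by (rule c) (use ds(3)[of x y] le in \<open>auto simp: Z_def\<close>)
    qed (use True ds(1) in auto)
  next
    case False
    show ?thesis
    \<comment> \<open>Around a centre in \<open>Z\<close> the whole core is declared to lie beyond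
      the radius.\<close>
    proof (rule exI[of _ "\<lambda>x. if x < h then Suc ((2 * k + 1) * R) else 0"], rule exI[of _ "\<lambda>_. False"],
        intro conjI allI impI)
      fix x y assume xy: "adj x y"
      note c = cases_adj[OF xy]
      show "(if y < h then Suc ((2 * k + 1) * R) else 0) \<le> Suc (if x < h then Suc ((2 * k + 1) * R) else 0)"
        by (rule c) auto
      assume "(if x < h then Suc ((2 * k + 1) * R) else 0) \<le> (2 * k + 1) * R"
      then have "h \<le> x" by (cases "x < h") auto
      then show "(False \<noteq> False) = (x \<notin> Z)" by (simp add: Z_def)
    qed (use False in auto)
  qed
  define \<pi> where "\<pi> x = (SOME f. bij_betw f {y. adj x y} {..<18 :: nat})" for x
  have port: "bij_betw (\<pi> x) {y. adj x y} {..<18}" if "x < n" for x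
  proof -
    have "finite {y. adj x y}" using degree[OF that] by (intro card_ge_0_finite) simp
    then have "\<exists>f. bij_betw f {y. adj x y} {..<18 :: nat}"
      using degree[OF that] by (intro finite_same_card_bij) auto
    then show ?thesis unfolding \<pi>_def by (rule someI_ex)
  qed
  have "switched_graph n adj Z ((2 * k + 1) * R) \<pi>"
  proof (intro switched_graph.intro switched_graph_axioms.intro)
    show "lifted_graph n adj (\<lambda>_. True)"
      by (rule lifted_graph.intro; (rule dom sym degree refl TrueI, assumption?))
    show "lifted_graph n adj (\<lambda>x. x \<in> Z)"
      by (rule lifted_graph.intro; (rule dom sym degree Zeq Zloop, assumption))
  qed (rule switch port, assumption)+
  moreover have "36 * ((m + 4) div 5) \<le> card {(x, y). adj x y \<and> x \<notin> Z \<and> col x = col y}"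
    for col :: "nat \<Rightarrow> bool"
  proof -
    have "{(x, y). adj x y \<and> x \<notin> Z \<and> col x = col y} = mono_pairs adj1 col"
      using adj1(1) by (fastforce simp: adj_def Z_def mono_pairs_def)
    then show ?thesis using mono[of col] by simp
  qed
  ultimately show ?thesis by blast
qed

text \<open>Counting edges from both sides shows that the sides have equal size. So every admissible
  number of vertices is even, as it is for a two-fold lift.\<close>

lemma even_card_regular_bipartite:
  assumes reg: "regular_graph d V E" and bip: "bipartite V E" and d: "0 < d"
  shows "even (card V)"
proof -
  obtain S T where ST: "S \<union> T = V" "S \<inter> T = {}" "crossing_edges E S T = E"
    using bip by (auto simp: bipartite_def)
  have fin: "finite S" "finite T" using reg ST(1) by (auto simp: regular_graph_def simple_graph_def)
  have cross: "e \<inter> S \<noteq> {} \<and> e \<inter> T \<noteq> {} \<and> e \<subseteq> V" if "e \<in> E" for e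
    using that ST(3) reg by (auto simp: crossing_edges_def regular_graph_def simple_graph_def)
  have nS: "neighbours E x = {y \<in> T. {x, y} \<in> E}" if "x \<in> S" for x
    using that ST cross[of "{_, x}"] by (auto simp: neighbours_def insert_commute)
  have nT: "neighbours E y = {x \<in> S. {x, y} \<in> E}" if "y \<in> T" for y
    using that ST cross[of "{_, y}"] by (auto simp: neighbours_def)
  have deg: "card (neighbours E x) = d" if "x \<in> V" for x
    using reg that by (auto simp: regular_graph_def vertex_degree_def)
  have cS: "card {y \<in> T. {x, y} \<in> E} = d" if "x \<in> S" for x
    using nS[OF that] deg[of x] that ST(1) by auto
  have cT: "card {x \<in> S. {x, y} \<in> E} = d" if "y \<in> T" for y
    using nT[OF that] deg[of y] that ST(1) by auto
  have "d * card S = (\<Sum>x\<in>S. card {y \<in> T. {x, y} \<in> E})" by (simp add: cS)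
  also have "\<dots> = (\<Sum>y\<in>T. d)"
    by (rule sum_multicount_gen) (use fin cT in auto)
  finally have "card S = card T" using d by simp
  then show ?thesis using card_Un_disjoint[OF fin ST(2)] ST(1) by simp
qed

lemma eventually_size_bounds:
  fixes K :: real
  assumes "0 < K"
  shows "eventually (\<lambda>n :: nat. 16 \<le> ln (real n) \<and>
    21600 * sqrt (real n) \<le> (real n / 2 - 18) / (36 * K) - 1) sequentially"
proof (intro eventually_conj)
  show "eventually (\<lambda>n :: nat. 16 \<le> ln (real n)) sequentially" by real_asymp
  show "eventually (\<lambda>n :: nat. 21600 * sqrt (real n) \<le> (real n / 2 - 18) / (36 * K) - 1) sequentially"
    using assms by real_asymp
qed

text \<open>With \<open>k\<close> about \<open>1 / (3000 * \<epsilon>)\<close>, \<open>m\<close>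
  about \<open>n / (36 * K)\<close> and \<open>R\<close> about \<open>ln (2 * n) / 8\<close>, too
  few rounds would stay within radius \<open>(2 * k + 1) * R\<close>. The copies lose at least
  \<open>7.2 * m\<close> edges, while the guarantee allows at most \<open>18 * \<epsilon> * n \<le>
  720 * \<epsilon> * K * m \<le> 5.04 * m\<close>.\<close>

lemma rounds_lower_bound:
  fixes \<epsilon> :: real and n :: nat
  defines "k \<equiv> nat \<lfloor>1 / (3000 * \<epsilon>)\<rfloor>"
  assumes eps: "0 < \<epsilon>" "\<epsilon> \<le> 0.001" and A: "approximates_bipartite_max_cut 18 \<epsilon> A"
    and ln: "16 \<le> ln (real (2 * n))"
    and size: "21600 * sqrt (real (2 * n)) \<le> (real (2 * n) / 2 - 18) / (36 * real (1 + 18 * k)) - 1"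
  shows "ln (real (2 * n)) / (48000 * \<epsilon>) \<le> real (rounds A (2 * n))"
proof (rule ccontr)
  assume "\<not> ?thesis"
  then have lt: "real (rounds A (2 * n)) < ln (real (2 * n)) / (48000 * \<epsilon>)" by simp
  define K where "K = 1 + 18 * k"
  define m where "m = (n - 18) div (36 * K)"
  define R where "R = nat \<lfloor>ln (real (2 * n)) / 8\<rfloor>"
  have n0: "0 < n" using ln by (cases n) auto
  have K: "0 < K" by (simp add: K_def)
  have k_le: "real k \<le> 1 / (3000 * \<epsilon>)" and k_ge: "1 / (3000 * \<epsilon>) \<le> real k + 1"
    using eps(1) unfolding k_def by (simp_all add: of_nat_nat)
  \<comment> \<open>\<open>0.001\<close> from the summand 1 in \<open>K\<close> and
    \<open>18 / 3000 = 0.006\<close> from \<open>18 * k\<close>.\<close>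
  have K_le: "\<epsilon> * real K \<le> 0.007"
  proof -
    have "\<epsilon> * real k \<le> 1 / 3000" using k_le eps(1) by (simp add: field_simps)
    then show ?thesis using eps(2) by (simp add: K_def algebra_simps)
  qed
  have sq: "1 \<le> sqrt (real (2 * n))" using n0 by simp
  have size': "21600 * sqrt (real (2 * n)) \<le> (real n - 18) / (36 * real K) - 1"
    using size by (simp add: K_def)
  then have "0 \<le> (real n - 18) / (36 * real K)" using sq by linarith
  then have n18: "18 \<le> n" using K by (simp add: zero_le_divide_iff)
  have m_gt: "n - 18 < 36 * K * (m + 1)"
    using dividend_less_div_times[of "36 * K" "n - 18"] K by (simp add: m_def algebra_simps)
  have m_le: "36 * K * m \<le> n - 18" unfolding m_def by (rule times_div_less_eq_dividend)
  have m_sqrt: "21600 * sqrt (real (2 * n)) \<le> real m"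
  proof -
    have "real n - 18 \<le> 36 * real K * (real m + 1)"
      using m_gt n18 of_nat_mono[OF less_imp_le[OF m_gt], where 'a = real] by (simp add: of_nat_diff algebra_simps)
    then have "(real n - 18) / (36 * real K) - 1 \<le> real m" using K by (simp add: field_simps)
    then show ?thesis using size' by linarith
  qed
  then have m200: "200 \<le> m" using sq by linarith
  have "real R = of_int \<lfloor>ln (real (2 * n)) / 8\<rfloor>"
    unfolding R_def using ln by (intro of_nat_nat) simp
  then have R_le: "real R \<le> ln (real (2 * n)) / 8" and R_ge: "ln (real (2 * n)) / 8 - 1 \<le> real R"
    by linarith+
  \<comment> \<open>The girth condition needs
    \<open>100 * 6 ^ 3 * 36 ^ R = 21600 * 36 ^ R \<le> m\<close>; since
    \<open>36 \<le> exp 4\<close>, the power is at most \<open>sqrt (2 * n)\<close>.\<close>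
  have "(36 :: real) ^ R \<le> exp 4 ^ R"
  proof (intro power_mono)
    have "(36 :: real) \<le> (1 + 1 / 2 + (1 / 2)\<^sup>2 / 2) ^ 8" by (simp add: power_divide power2_eq_square)
    also have "\<dots> \<le> exp (1 / 2) ^ 8"
      using exp_lower_Taylor_quadratic[of "1 / 2 :: real"] by (intro power_mono) auto
    also have "\<dots> = exp 4" by (simp flip: exp_of_nat_mult)
    finally show "(36 :: real) \<le> exp 4" .
  qed auto
  also have "\<dots> = exp (4 * real R)" by (simp flip: exp_of_nat_mult add: mult.commute)
  also have "\<dots> \<le> exp (ln (real (2 * n)) / 2)" using R_le by simp
  also have "\<dots> = sqrt (real (2 * n))"
    using n0 by (simp add: ln_sqrt[symmetric])
  finally have "21600 * (36 :: real) ^ R \<le> real m" using m_sqrt by linarith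
  then have "real (21600 * 36 ^ R) \<le> real m" by simp
  then have "21600 * 36 ^ R \<le> m" by (simp only: of_nat_le_iff)
  moreover have "100 * 6 ^ (2 * R + 3) = 21600 * (36 :: nat) ^ R"
    by (simp add: power_add power_mult)
  ultimately have R6: "100 * 6 ^ (2 * R + 3) \<le> m" by simp
  have fits: "36 * (m * (1 + 18 * k)) + 18 \<le> n"
    using m_le n18 by (simp add: K_def algebra_simps)
  obtain adj Z \<pi> where sw: "switched_graph n adj Z ((2 * k + 1) * R) \<pi>"
    and mono: "\<And>col :: nat \<Rightarrow> bool. 36 * ((m + 4) div 5) \<le> card {(x, y). adj x y \<and> x \<notin> Z \<and> col x = col y}"
    using exists_switched_graph[OF m200 R6 fits] by blast
  have rounds: "rounds A (2 * n) \<le> (2 * k + 1) * R"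
  proof -
    \<comment> \<open>\<open>48000 = 3000 * 16\<close>: as the logarithm is at least 16, a sixteenth
      of it is at most an eighth minus 1, hence at most \<open>R\<close>.\<close>
    have "ln (real (2 * n)) / (48000 * \<epsilon>) = 1 / (3000 * \<epsilon>) * (ln (real (2 * n)) / 16)" by simp
    also have "\<dots> \<le> (real k + 1) * real R"
      using k_ge R_ge ln eps(1) by (intro mult_mono) auto
    also have "\<dots> \<le> real ((2 * k + 1) * R)" by (simp add: mult_right_mono algebra_simps)
    finally show ?thesis using lt by linarith
  qed
  have "real (36 * ((m + 4) div 5)) \<le> \<epsilon> * (18 * n)"
    using switched_graph.approximation_bound[OF sw A rounds mono] by simp
  moreover have "7.2 * real m \<le> real (36 * ((m + 4) div 5))" by linarith
  moreover have "real n \<le> 40 * real K * real m"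
  proof -
    have "n \<le> 36 * K * m + (36 * K + 18)" using m_gt n18 by (simp add: algebra_simps)
    also have "36 * K + 18 \<le> 4 * K * m"
    proof -
      \<comment> \<open>As \<open>K\<close> is positive, \<open>36 * K + 18 \<le> 54 * K\<close>,
        which is below \<open>4 * 14 * K\<close>.\<close>
      have "4 * K * 14 \<le> 4 * K * m" using m200 by (intro mult_le_mono) auto
      then show ?thesis using K by linarith
    qed
    finally have "n \<le> 40 * K * m" by (simp add: algebra_simps)
    then have "real n \<le> real (40 * K * m)" by (rule of_nat_mono)
    then show ?thesis by simp
  qed
  moreover have "\<epsilon> * real K * real m \<le> 0.007 * real m" using K_le by (intro mult_right_mono) auto
  ultimately have "7.2 * real m \<le> 720 * (0.007 * real m)"
  proof -
    assume h: "real (36 * ((m + 4) div 5)) \<le> \<epsilon> * (18 * n)" "7.2 * real m \<le> real (36 * ((m + 4) div 5))"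
      "real n \<le> 40 * real K * real m" "\<epsilon> * real K * real m \<le> 0.007 * real m"
    have "\<epsilon> * real n \<le> \<epsilon> * (40 * real K * real m)" using h(3) eps(1) by (intro mult_left_mono) auto
    then show ?thesis using h by (simp add: algebra_simps)
  qed
  then show False using m200 by simp
qed

theorem theoremB8:
  shows "\<exists>c::real. c > 0 \<and>
    (\<forall>\<epsilon>::real. 0 < \<epsilon> \<and> \<epsilon> \<le> 0.001 \<longrightarrow>
      (\<exists>N::nat. \<forall>A. approximates_bipartite_max_cut 18 \<epsilon> A \<longrightarrow>
        (\<forall>V E. regular_graph 18 V E \<and> bipartite V E \<and> card V \<ge> N \<longrightarrow>
          real (rounds A (card V)) \<ge> c * (ln (real (card V)) / \<epsilon>))))"
proof (intro exI[of _ "1 / 48000"] conjI allI impI)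
  fix \<epsilon> :: real assume eps: "0 < \<epsilon> \<and> \<epsilon> \<le> 0.001"
  \<comment> \<open>The length of the paths depends on \<open>\<epsilon>\<close>, and so does the
    threshold \<open>N\<close>; the constant \<open>1 / 48000\<close> does not.\<close>
  define K where "K = real (1 + 18 * nat \<lfloor>1 / (3000 * \<epsilon>)\<rfloor>)"
  have "0 < K" by (simp add: K_def)
  then obtain N :: nat where N: "\<And>n. N \<le> n \<Longrightarrow> 16 \<le> ln (real n) \<and>
      21600 * sqrt (real n) \<le> (real n / 2 - 18) / (36 * K) - 1"
    using eventually_size_bounds unfolding eventually_sequentially by blast
  show "\<exists>N. \<forall>A. approximates_bipartite_max_cut 18 \<epsilon> A \<longrightarrow>
        (\<forall>V E. regular_graph 18 V E \<and> bipartite V E \<and> card V \<ge> N \<longrightarrow>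
          real (rounds A (card V)) \<ge> 1 / 48000 * (ln (real (card V)) / \<epsilon>))"
  proof (intro exI[of _ N] allI impI)
    fix A V E assume A: "approximates_bipartite_max_cut 18 \<epsilon> A"
      and VE: "regular_graph 18 V E \<and> bipartite V E \<and> card V \<ge> N"
    have "even (card V)" by (rule even_card_regular_bipartite[of 18 V E]) (use VE in auto)
    then obtain n where n: "card V = 2 * n" by (elim evenE)
    have "16 \<le> ln (real (2 * n))"
      "21600 * sqrt (real (2 * n)) \<le> (real (2 * n) / 2 - 18) / (36 * K) - 1"
      using N[of "2 * n"] VE n by auto
    then have "ln (real (2 * n)) / (48000 * \<epsilon>) \<le> real (rounds A (2 * n))"
      using eps A unfolding K_def by (intro rounds_lower_bound) auto
    then show "real (rounds A (card V)) \<ge> 1 / 48000 * (ln (real (card V)) / \<epsilon>)"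
      by (simp add: n)
  qed
qed simp

end
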